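(* Let $n\geq 3$ and let $\tilde H_{K_n}$ be the matrix defined below for the complete graph $K_n$. Then the eigenvalues of $\tilde H_{K_{n}}$ are $-2n^{n-4}$, $-n^{n-3}$ and $2(n-2)n^{n-3}$, and the dimensions of the corresponding eigenspaces are $\binom{n}{2}-n$, $n-1$ and $1$, respectively.
   Context: For a connected graph $\Gamma$ with edge set $E(\Gamma)$, assign a variable $x_e$ to each edge $e$. The Kirchhoff polynomial is $F_\Gamma=\sum_{T}\prod_{e\in E(T)}x_e$, the sum over all spanning trees $T$ of $\Gamma$. The Hessian matrix of $\Gamma$ is $H_\Gamma=\left(\frac{\partial^2 F_\Gamma}{\partial x_i\partial x_j}\right)_{i,j\in E(\Gamma)}$, and $\tilde H_\Gamma$ denotes $H_\Gamma$ evaluated at $x_e=1$ for all edges $e$. (Equivalently, the $(i,j)$ entry of $\tilde H_\Gamma$ is $0$ if $i=j$ and is the number of spanning trees of $\Gamma$ containing both edges $i$ and $j$ if $i\neq j$.) $K_n$ is the complete graph on $n$ vertices.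
   Formalization: For n=3 the value -2n^{n-4} = -2/3 is not an eigenvalue (its eigenspace has dimension C(3,2)-3 = 0), so the set of eigenvalues is stated without it when n=3; the dimension claims are proved for all n≥3. *)

theory Defs
  imports
    "HOL-Analysis.Derivative"
    "Jordan_Normal_Form.Char_Poly"
    "Jordan_Normal_Form.Matrix_Kernel"
begin

text \<open>Finite simple graphs are given by a vertex set \<open>V\<close> and a set \<open>E\<close> of two-element subsets of \<open>V\<close>.\<close>

definition complete_edges :: "'v set \<Rightarrow> 'v set set" where
  "complete_edges V = {e. e \<subseteq> V \<and> card e = 2}"

definition graph_connected :: "'v set \<Rightarrow> 'v set set \<Rightarrow> bool" where
  "graph_connected V E \<longleftrightarrow>
     V \<noteq> {} \<and> (\<forall>u\<in>V. \<forall>v\<in>V. (u, v) \<in> {(a, b). {a, b} \<in> E}\<^sup>*)"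

text \<open>A cycle is listed by its pairwise distinct vertices; the last one is joined to the first.\<close>

definition graph_cycle :: "'v set set \<Rightarrow> 'v list \<Rightarrow> bool" where
  "graph_cycle E vs \<longleftrightarrow>
     3 \<le> length vs \<and> distinct vs \<and>
     (\<forall>i<length vs. {vs ! i, vs ! (Suc i mod length vs)} \<in> E)"

definition graph_tree :: "'v set \<Rightarrow> 'v set set \<Rightarrow> bool" where
  "graph_tree V E \<longleftrightarrow> graph_connected V E \<and> \<not> (\<exists>vs. graph_cycle E vs)"

definition spanning_trees :: "'v set \<Rightarrow> 'v set set \<Rightarrow> 'v set set set" where
  "spanning_trees V E = {T. T \<subseteq> E \<and> graph_tree V T}"

text \<open>The Kirchhoff polynomial is represented by its polynomial function on real edge weights.\<close>

definition kirchhoff_poly :: "'v set \<Rightarrow> 'v set set \<Rightarrow> ('v set \<Rightarrow> real) \<Rightarrow> real" where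
  "kirchhoff_poly V E x = (\<Sum>T\<in>spanning_trees V E. \<Prod>e\<in>T. x e)"

definition partial_deriv :: "'e \<Rightarrow> (('e \<Rightarrow> real) \<Rightarrow> real) \<Rightarrow> ('e \<Rightarrow> real) \<Rightarrow> real" where
  "partial_deriv e f x = deriv (\<lambda>t. f (x(e := t))) (x e)"

text \<open>Rows and columns of the Hessian are indexed by edges; the list \<open>es\<close> is an enumeration
  of the edge set, which fixes their order.\<close>

definition hessian_mat :: "'v set \<Rightarrow> 'v set list \<Rightarrow> ('v set \<Rightarrow> real) \<Rightarrow> real mat" where
  "hessian_mat V es x =
     mat (length es) (length es)
       (\<lambda>(i, j). partial_deriv (es ! i) (partial_deriv (es ! j) (kirchhoff_poly V (set es))) x)"

definition hessian_mat_at_one :: "'v set \<Rightarrow> 'v set list \<Rightarrow> real mat" where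
  "hessian_mat_at_one V es = hessian_mat V es (\<lambda>_. 1)"

text \<open>The eigenspace of \<open>A\<close> for \<open>k\<close> is the kernel of \<open>char_matrix A k\<close>, which is \<open>A - k I\<close>.\<close>

definition eigenspace_dim :: "real mat \<Rightarrow> real \<Rightarrow> nat" where
  "eigenspace_dim A k = kernel_dim (char_matrix A k)"

end

theory Submission
  imports Defs
begin

text \<open>
  If a forest \<open>F\<close> in the complete graph on \<open>n\<close> vertices has \<open>k\<close> components of sizes
  \<open>a\<^sub>1, \<dots>, a\<^sub>k\<close>, then \<open>n\<^sup>k\<^sup>-\<^sup>2 a\<^sub>1 \<cdots> a\<^sub>k\<close> spanning trees contain it. This follows by induction
  on \<open>k\<close>: counting pairs \<open>(T, e)\<close> of a tree \<open>T \<supseteq> F\<close> and an edge \<open>e \<in> T - F\<close> expresses \<open>k - 1\<close> times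
  the number for \<open>F\<close> through the numbers for \<open>F \<union> {e}\<close>, which have one component less. Hence two
  distinct edges \<open>e\<close>, \<open>f\<close> lie in \<open>n\<^sup>n\<^sup>-\<^sup>4 (4 - |e \<inter> f|)\<close> common spanning trees, and with the
  vertex-edge incidence matrix \<open>B\<close> (rows indexed by edges) the Hessian is
  \<open>n\<^sup>n\<^sup>-\<^sup>4 (4J - 2I - BB\<^sup>T)\<close>. Let \<open>v\<close> be an eigenvector for \<open>n\<^sup>n\<^sup>-\<^sup>4 t\<close>, \<open>s\<close> the sum of its entries
  and \<open>z = B\<^sup>T v\<close>. Then \<open>(t + 2) v = 4s - Bz\<close>, and applying \<open>B\<^sup>T\<close>, with \<open>B\<^sup>T B = (n - 2) I + J\<close>,
  gives \<open>(t + n) z = (4n - 6) s\<close> and then \<open>(t - 2n(n - 2)) s = 0\<close>. Therefore the eigenspaces are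
  \<open>ker B\<^sup>T\<close>, the image under \<open>B\<close> of the vectors with sum zero, and the constant vectors.
\<close>

unbundle no vec_syntax

section \<open>Reachability and forests\<close>

text \<open>The relation is the one in \<open>graph_connected\<close>, so connectedness becomes
  equality of these sets. No vertex set enters: a vertex on no edge is a component by
  itself.\<close>

definition reach :: "'v set set \<Rightarrow> 'v \<Rightarrow> 'v set" where
  "reach F a = {b. (a, b) \<in> {(a, b). {a, b} \<in> F}\<^sup>*}"

lemma reach_refl [simp]: "a \<in> reach F a"
  by (simp add: reach_def)

lemma reach_sym: "b \<in> reach F a \<Longrightarrow> a \<in> reach F b"
proof -
  have "sym {(a, b). {a, b} \<in> F}" by (auto simp: sym_def insert_commute)
  then show "b \<in> reach F a \<Longrightarrow> a \<in> reach F b"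
    unfolding reach_def using sym_rtrancl symD by fastforce
qed

lemma reach_trans: "b \<in> reach F a \<Longrightarrow> c \<in> reach F b \<Longrightarrow> c \<in> reach F a"
  by (auto simp: reach_def)

lemma reach_edge: "{a, b} \<in> F \<Longrightarrow> b \<in> reach F a"
  by (auto simp: reach_def)

lemma reach_mono: "F \<subseteq> F' \<Longrightarrow> reach F a \<subseteq> reach F' a"
  unfolding reach_def by (auto elim!: rtrancl_mono[THEN subsetD, rotated])

lemma reach_eq_iff: "reach F a = reach F b \<longleftrightarrow> b \<in> reach F a"
proof
  assume "reach F a = reach F b"
  then show "b \<in> reach F a" by simp
next
  assume "b \<in> reach F a"
  then show "reach F a = reach F b"
    using reach_trans[of a F b] reach_trans[of b F a] reach_sym[of b F a] by blast
qed

lemma reach_induct [consumes 1, case_names base step]: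
  assumes "b \<in> reach F a" "P a"
    "\<And>x y. x \<in> reach F a \<Longrightarrow> {x, y} \<in> F \<Longrightarrow> P x \<Longrightarrow> P y"
  shows "P b"
proof -
  have "(a, b) \<in> {(a, b). {a, b} \<in> F}\<^sup>*" using assms(1) by (simp add: reach_def)
  then show ?thesis
    by (induction rule: rtrancl_induct) (use assms(2,3) in \<open>auto simp: reach_def\<close>)
qed

lemma reach_subset:
  assumes "b \<in> reach F a" "a \<in> V" "F \<subseteq> Pow V"
  shows "b \<in> V"
  using assms by (induction rule: reach_induct) auto

lemma reach_empty [simp]: "reach {} a = {a}"
  by (auto simp: reach_def)

text \<open>Along a walk, an old edge stays in its component under \<open>F\<close>, and the new
  edge stays in the union of the components of its ends. If both ends already lie together, the
  union is that component.\<close>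

lemma reach_insert:
  "reach (insert {a, b} F) x =
     (if x \<in> reach F a \<union> reach F b then reach F a \<union> reach F b else reach F x)"
proof -
  have m: "reach F y \<subseteq> reach (insert {a, b} F) y" for y
    by (rule reach_mono) auto
  have ab: "b \<in> reach (insert {a, b} F) a" by (rule reach_edge) simp
  have "y \<in> (if x \<in> reach F a \<union> reach F b then reach F a \<union> reach F b else reach F x)"
    if "y \<in> reach (insert {a, b} F) x" for y
    using that
  proof (induction rule: reach_induct)
    case base
    then show ?case by auto
  next
    case (step y z)
    show ?case
    proof (cases "{y, z} = {a, b}")
      case True
      then have "y = a \<and> z = b \<or> y = b \<and> z = a" by (auto simp: doubleton_eq_iff)
      then show ?thesis using step.IH reach_sym[of _ F x] by (auto split: if_splits)
    next
      case False
      then have "z \<in> reach F y" using step.hyps by (auto intro: reach_edge)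
      then show ?thesis using step.IH reach_trans[of y F _ z] by (auto split: if_splits)
    qed
  qed
  moreover have "y \<in> reach (insert {a, b} F) x" 
    if "y \<in> (if x \<in> reach F a \<union> reach F b then reach F a \<union> reach F b else reach F x)" for y
  proof (cases "x \<in> reach F a \<union> reach F b")
    case False
    then show ?thesis using that m by auto
  next
    case True
    then have "a \<in> reach (insert {a, b} F) x"
      using m ab by (meson UnE reach_sym reach_trans subsetD)
    moreover have "y \<in> reach (insert {a, b} F) a"
      using True that m ab by (metis UnE reach_trans subsetD)
    ultimately show ?thesis by (rule reach_trans)
  qed
  ultimately show ?thesis by blast
qed

text \<open>Every edge is a bridge. This form of acyclicity speaks only of \<open>reach\<close>, so
  it can be followed through the insertion of one edge, unlike cycles listed by their
  vertices.\<close>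

definition bridged :: "'v set set \<Rightarrow> bool" where
  "bridged F \<longleftrightarrow> (\<forall>a b. {a, b} \<in> F \<longrightarrow> b \<notin> reach (F - {{a, b}}) a)"

lemma bridged_subset: "bridged F \<Longrightarrow> F' \<subseteq> F \<Longrightarrow> bridged F'"
proof (unfold bridged_def, intro allI impI)
  fix a b
  assume F: "\<forall>a b. {a, b} \<in> F \<longrightarrow> b \<notin> reach (F - {{a, b}}) a" and F': "F' \<subseteq> F"
    and "{a, b} \<in> F'"
  moreover have "reach (F' - {{a, b}}) a \<subseteq> reach (F - {{a, b}}) a"
    using F' by (intro reach_mono) auto
  ultimately show "b \<notin> reach (F' - {{a, b}}) a" by auto
qed

lemma bridged_insert:
  assumes "bridged F" "b \<notin> reach F a"
  shows "bridged (insert {a, b} F)"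
  unfolding bridged_def
proof (intro allI impI)
  fix c d assume cd: "{c, d} \<in> insert {a, b} F"
  have nin: "{a, b} \<notin> F" using assms(2) reach_edge[of a b F] by auto
  show "d \<notin> reach (insert {a, b} F - {{c, d}}) c"
  proof (cases "{c, d} = {a, b}")
    case True
    then have "insert {a, b} F - {{c, d}} = F" using nin by auto
    moreover have "c = a \<and> d = b \<or> c = b \<and> d = a" using True by (simp only: doubleton_eq_iff)
    moreover have "a \<notin> reach F b" using assms(2) reach_sym[of a F b] by blast
    ultimately show ?thesis using assms(2) by fastforce
  next
    case False
    then have eq: "insert {a, b} F - {{c, d}} = insert {a, b} (F - {{c, d}})" by auto
    let ?G = "F - {{c, d}}"
    have cdF: "{c, d} \<in> F" using cd False by auto
    have d: "d \<notin> reach ?G c" using cdF assms(1) by (auto simp: bridged_def)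
    have sub: "reach ?G x \<subseteq> reach F x" for x by (rule reach_mono) auto
    have "d \<in> reach F c" "c \<in> reach F d" 
      using reach_edge[OF cdF] reach_sym[OF reach_edge[OF cdF]] by simp_all
    \<comment> \<open>If the new edge joined the side of \<open>c\<close> to the side of
      \<open>d\<close>, then the edge \<open>{c, d}\<close> of \<open>F\<close> would already link
      \<open>a\<close> and \<open>b\<close> in \<open>F\<close>.\<close>
    then have "\<not> (c \<in> reach ?G a \<and> d \<in> reach ?G b)" "\<not> (c \<in> reach ?G b \<and> d \<in> reach ?G a)"
      using assms(2) sub by (meson reach_sym reach_trans subsetD)+
    moreover have "\<not> (c \<in> reach ?G x \<and> d \<in> reach ?G x)" for x
      using d reach_sym reach_trans by metis
    ultimately show ?thesis unfolding eq reach_insert using d by auto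
  qed
qed

lemma reach_imp_path:
  assumes "b \<in> reach F a"
  shows "\<exists>vs. vs \<noteq> [] \<and> distinct vs \<and> hd vs = a \<and> last vs = b \<and>
    (\<forall>i. Suc i < length vs \<longrightarrow> {vs ! i, vs ! Suc i} \<in> F)"
  using assms
proof (induction rule: reach_induct)
  case base
  show ?case by (rule exI[of _ "[a]"]) simp
next
  case (step x y)
  then obtain vs where vs: "vs \<noteq> []" "distinct vs" "hd vs = a" "last vs = x"
    and e: "\<And>i. Suc i < length vs \<Longrightarrow> {vs ! i, vs ! Suc i} \<in> F" by blast
  show ?case
  proof (cases "y \<in> set vs")
    case True
    then obtain k where k: "k < length vs" "vs ! k = y" by (auto simp: in_set_conv_nth)
    \<comment> \<open>A vertex met again is reached by cutting the path at its earlier visit, which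
      keeps it free of repetitions.\<close>
    have "last (take (Suc k) vs) = y"
      using k by (simp add: take_Suc_conv_app_nth)
    with vs k e show ?thesis
      by (intro exI[of _ "take (Suc k) vs"]) auto
  next
    case False
    have "{(vs @ [y]) ! i, (vs @ [y]) ! Suc i} \<in> F" if "Suc i < length (vs @ [y])" for i
    proof (cases "Suc i < length vs")
      case True
      then show ?thesis using e[of i] by (simp add: nth_append)
    next
      case False
      then have "i = length vs - 1" "Suc i = length vs" using that vs(1) by auto
      then have "(vs @ [y]) ! i = x" "(vs @ [y]) ! Suc i = y"
        using vs(1,4) by (simp_all add: nth_append last_conv_nth)
      then show ?thesis using step.hyps(2) by simp
    qed
    then show ?thesis using vs False
      by (intro exI[of _ "vs @ [y]"]) auto
  qed
qed

text \<open>A path between the ends of an edge that avoids this edge closes to a cycle, and a cycle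
  minus its closing edge is such a path. The size assumption excludes loops, which violate
  \<open>bridged\<close> without giving a cycle.\<close>

lemma acyclic_iff_bridged:
  assumes two: "\<And>e. e \<in> F \<Longrightarrow> card e = 2"
  shows "\<not> (\<exists>vs. graph_cycle F vs) \<longleftrightarrow> bridged F"
proof
  assume nc: "\<not> (\<exists>vs. graph_cycle F vs)"
  show "bridged F"
    unfolding bridged_def
  proof (intro allI impI notI)
    fix a b assume ab: "{a, b} \<in> F" and r: "b \<in> reach (F - {{a, b}}) a"
    have "a \<noteq> b" using two[OF ab] by auto
    obtain vs where vs: "vs \<noteq> []" "distinct vs" "hd vs = a" "last vs = b"
      and e: "\<And>i. Suc i < length vs \<Longrightarrow> {vs ! i, vs ! Suc i} \<in> F - {{a, b}}"
      using reach_imp_path[OF r] by blast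
    have first: "vs ! 0 = a" and lst: "vs ! (length vs - 1) = b"
      using vs by (simp_all add: hd_conv_nth last_conv_nth)
    \<comment> \<open>Length 1 would give \<open>a = b\<close>, and length 2 would use the deleted
      edge.\<close>
    have "length vs \<noteq> 0" "length vs \<noteq> 1" "length vs \<noteq> 2"
      using vs(1) first lst \<open>a \<noteq> b\<close> e[of 0] by auto
    then have len: "3 \<le> length vs" by linarith
    have "{vs ! i, vs ! (Suc i mod length vs)} \<in> F" if "i < length vs" for i
    proof (cases "Suc i < length vs")
      case True
      then show ?thesis using e[of i] by simp
    next
      case False
      then have "Suc i = length vs" "i = length vs - 1" using that by auto
      then show ?thesis using first lst ab by (simp add: insert_commute)
    qed
    then have "graph_cycle F vs" using len vs(2) by (simp add: graph_cycle_def)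
    then show False using nc by blast
  qed
next
  assume br: "bridged F"
  show "\<not> (\<exists>vs. graph_cycle F vs)"
  proof
    assume "\<exists>vs. graph_cycle F vs"
    then obtain vs where len: "3 \<le> length vs" and dis: "distinct vs"
      and e: "\<And>i. i < length vs \<Longrightarrow> {vs ! i, vs ! (Suc i mod length vs)} \<in> F"
      by (auto simp: graph_cycle_def)
    define m where "m = length vs - 1"
    have m: "length vs = Suc m" "2 \<le> m" using len by (auto simp: m_def)
    let ?e = "{vs ! 0, vs ! m}"
    have "?e \<in> F" using e[of m] m by (simp add: insert_commute)
    have "vs ! i \<in> reach (F - {?e}) (vs ! 0)" if "i \<le> m" for i
      using that
    proof (induction i)
      case (Suc i)
      have "{vs ! i, vs ! Suc i} \<in> F" using e[of i] Suc.prems m by simp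
      \<comment> \<open>This needs three vertices: two consecutive indices form the pair
        \<open>{0, m}\<close> only if \<open>m = 1\<close>.\<close>
      moreover have "{vs ! i, vs ! Suc i} \<noteq> ?e"
        using dis m Suc.prems by (auto simp: doubleton_eq_iff nth_eq_iff_index_eq)
      ultimately have "vs ! Suc i \<in> reach (F - {?e}) (vs ! i)" by (intro reach_edge) simp
      then show ?case using Suc reach_trans[of "vs ! i"] by simp
    qed simp
    then show False using br \<open>?e \<in> F\<close> unfolding bridged_def by blast
  qed
qed

section \<open>Counting spanning trees of the complete graph that contain a forest\<close>

definition graph_components :: "'v set \<Rightarrow> 'v set set \<Rightarrow> 'v set set" where
  "graph_components V F = reach F ` V"

text \<open>Real-valued because joining components of sizes \<open>p\<close> and \<open>q\<close>
  multiplies it by \<open>1/p + 1/q\<close>.\<close>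

definition component_weight :: "'v set \<Rightarrow> 'v set set \<Rightarrow> real" where
  "component_weight V F = (\<Prod>C\<in>graph_components V F. real (card C))"

lemma finite_complete_edges: "finite V \<Longrightarrow> finite (complete_edges V)"
  by (rule finite_subset[of _ "Pow V"]) (auto simp: complete_edges_def)

lemma complete_edges_E:
  assumes "e \<in> complete_edges V"
  obtains a b where "a \<in> V" "b \<in> V" "a \<noteq> b" "e = {a, b}"
  using assms by (auto simp: complete_edges_def card_2_iff)

lemma doubleton_in_complete_edges [simp]:
  "{a, b} \<in> complete_edges V \<longleftrightarrow> a \<in> V \<and> b \<in> V \<and> a \<noteq> b"
  by (cases "a = b") (auto simp: complete_edges_def)

lemma reach_subset_vertices:
  assumes "F \<subseteq> complete_edges V" "a \<in> V"
  shows "reach F a \<subseteq> V"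
proof
  fix x assume "x \<in> reach F a"
  moreover have "F \<subseteq> Pow V" using assms(1) by (auto simp: complete_edges_def)
  ultimately show "x \<in> V" using assms(2) by (blast intro: reach_subset)
qed

lemma components_insert:
  assumes F: "F \<subseteq> complete_edges V" and ab: "a \<in> V" "b \<in> V" "b \<notin> reach F a"
  shows "graph_components V (insert {a, b} F) =
     insert (reach F a \<union> reach F b) (graph_components V F - {reach F a, reach F b})"
    (is "?L = ?R")
proof
  show "?L \<subseteq> ?R"
  proof
    fix C assume "C \<in> ?L"
    then obtain x where x: "x \<in> V" "C = reach (insert {a, b} F) x" by (auto simp: graph_components_def)
    show "C \<in> ?R"
    proof (cases "x \<in> reach F a \<union> reach F b")
      case True
      then show ?thesis using x by (simp add: reach_insert)
    next
      case False
      then have "reach F a \<noteq> reach F x" "reach F b \<noteq> reach F x"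
        by (simp_all add: reach_eq_iff)
      then show ?thesis using x False by (auto simp: reach_insert graph_components_def)
    qed
  qed
  show "?R \<subseteq> ?L"
  proof
    fix C assume "C \<in> ?R"
    then consider "C = reach F a \<union> reach F b" 
      | x where "x \<in> V" "C = reach F x" "reach F a \<noteq> reach F x" "reach F b \<noteq> reach F x"
      by (auto simp: graph_components_def)
    then show "C \<in> ?L"
    proof cases
      case 1
      then have "C = reach (insert {a, b} F) a" by (simp add: reach_insert)
      then show ?thesis using ab by (simp add: graph_components_def)
    next
      case 2
      then have "C = reach (insert {a, b} F) x" by (simp add: reach_insert reach_eq_iff)
      then show ?thesis using 2 by (simp add: graph_components_def)
    qed
  qed
qed

lemma merged_component_new:
  "reach F a \<union> reach F b \<notin> graph_components V F - {reach F a, reach F b}"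
proof
  assume "reach F a \<union> reach F b \<in> graph_components V F - {reach F a, reach F b}"
  then obtain x where x: "reach F x = reach F a \<union> reach F b" "reach F x \<noteq> reach F a"
    by (auto simp: graph_components_def)
  then have "a \<in> reach F x" by simp
  then show False using x(2) reach_eq_iff[of F x a] by simp
qed

text \<open>In the weight, the factor \<open>p q\<close> is replaced by
  \<open>p + q = p q (1/p + 1/q)\<close>, where \<open>p\<close> and \<open>q\<close> are the sizes
  of the two merged components.\<close>

lemma
  assumes V: "finite V" and F: "F \<subseteq> complete_edges V" and ab: "a \<in> V" "b \<in> V" "b \<notin> reach F a"
  shows card_components_insert: "card (graph_components V F) = Suc (card (graph_components V (insert {a, b} F)))"
    and component_weight_insert:
      "component_weight V (insert {a, b} F) =
         component_weight V F * (1 / real (card (reach F a)) + 1 / real (card (reach F b)))"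
proof -
  let ?A = "reach F a" and ?B = "reach F b" and ?D = "graph_components V F - {reach F a, reach F b}"
  have fin: "finite (graph_components V F)" using V by (simp add: graph_components_def)
  then have finD: "finite ?D" by simp
  have ne: "?A \<noteq> ?B" using ab(3) by (simp add: reach_eq_iff)
  have mem: "?A \<in> graph_components V F" "?B \<in> graph_components V F" using ab by (auto simp: graph_components_def)
  then have split: "graph_components V F = insert ?A (insert ?B ?D)" by auto
  have "card (graph_components V F) = Suc (Suc (card ?D))"
    by (subst split) (use finD ne in simp)
  moreover have ins: "graph_components V (insert {a, b} F) = insert (?A \<union> ?B) ?D"
    by (rule components_insert[OF F ab])
  moreover have card_ins: "card (insert (?A \<union> ?B) ?D) = Suc (card ?D)"
    by (rule card_insert_disjoint[OF finD merged_component_new])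
  ultimately show "card (graph_components V F) = Suc (card (graph_components V (insert {a, b} F)))" by simp
  have finA: "finite ?A" "finite ?B" using reach_subset_vertices[OF F] ab V by (meson finite_subset)+
  have pos: "card ?A > 0" "card ?B > 0" 
    using finA reach_refl[of a F] reach_refl[of b F]
    by (auto simp: card_gt_0_iff simp del: reach_refl)
  have "?A \<inter> ?B = {}" using ab(3) reach_sym[of _ F b] reach_trans[of _ F a b] by blast
  then have cU: "card (?A \<union> ?B) = card ?A + card ?B" using finA by (simp add: card_Un_disjoint)
  have w: "component_weight V F = real (card ?A) * (real (card ?B) * (\<Prod>C\<in>?D. real (card C)))"
    unfolding component_weight_def by (subst split) (use finD ne in simp)
  have "component_weight V (insert {a, b} F) = real (card (?A \<union> ?B)) * (\<Prod>C\<in>?D. real (card C))"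
    unfolding component_weight_def ins
    by (rule prod.insert[OF finD merged_component_new])
  then show "component_weight V (insert {a, b} F) =
         component_weight V F * (1 / real (card ?A) + 1 / real (card ?B))"
    using pos w cU by (simp add: field_simps)
qed

text \<open>Each bridge joins two different components and so lowers their number by one, starting
  from \<open>card V\<close> singletons.\<close>

lemma card_forest:
  assumes V: "finite V" and F: "F \<subseteq> complete_edges V" and br: "bridged F"
  shows "card F + card (graph_components V F) = card V"
proof -
  have "finite F" using F V finite_complete_edges finite_subset by blast
  then show ?thesis using F br
  proof (induction F rule: finite_induct)
    case empty
    have "inj_on (reach ({} :: 'a set set)) V" by (auto simp: inj_on_def)
    then show ?case by (simp add: graph_components_def card_image)
  next
    case (insert e F)
    obtain a b where e: "a \<in> V" "b \<in> V" "a \<noteq> b" "e = {a, b}"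
      using insert.prems(1) complete_edges_E by blast
    have "insert e F - {e} = F" using insert.hyps by auto
    then have nr: "b \<notin> reach F a" using insert.prems(2) e(4) unfolding bridged_def by fastforce
    have "bridged F" using insert.prems(2) bridged_subset by blast
    then have "card F + card (graph_components V F) = card V" using insert by blast
    moreover have "card (graph_components V F) = Suc (card (graph_components V (insert e F)))"
      using card_components_insert[OF V _ e(1,2) nr] insert.prems(1) e(4) by simp
    ultimately show ?case using insert.hyps by simp
  qed
qed

lemma card_components_eq_1_iff:
  assumes "finite V" "F \<subseteq> complete_edges V"
  shows "card (graph_components V F) = 1 \<longleftrightarrow> graph_connected V F"
proof -
  have "graph_connected V F \<longleftrightarrow> V \<noteq> {} \<and> (\<forall>u\<in>V. \<forall>v\<in>V. reach F u = reach F v)"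
    unfolding graph_connected_def reach_eq_iff by (simp add: reach_def)
  also have "\<dots> \<longleftrightarrow> (\<exists>C. graph_components V F = {C})"
  proof
    assume *: "V \<noteq> {} \<and> (\<forall>u\<in>V. \<forall>v\<in>V. reach F u = reach F v)"
    then obtain u where "u \<in> V" by blast
    with * have "graph_components V F = {reach F u}" unfolding graph_components_def by blast
    then show "\<exists>C. graph_components V F = {C}" by blast
  next
    assume "\<exists>C. graph_components V F = {C}"
    then obtain C where C: "reach F ` V = {C}" unfolding graph_components_def by blast
    then have "reach F u = C" if "u \<in> V" for u using that by blast
    then show "V \<noteq> {} \<and> (\<forall>u\<in>V. \<forall>v\<in>V. reach F u = reach F v)" using C by auto
  qed
  finally show ?thesis by (simp add: card_1_singleton_iff)
qed

lemma spanning_trees_complete: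
  assumes "finite V"
  shows "spanning_trees V (complete_edges V) =
    {T. T \<subseteq> complete_edges V \<and> card (graph_components V T) = 1 \<and> bridged T}"
proof -
  have "graph_tree V T \<longleftrightarrow> card (graph_components V T) = 1 \<and> bridged T"
    if "T \<subseteq> complete_edges V" for T
  proof -
    have "\<And>e. e \<in> T \<Longrightarrow> card e = 2" using that by (auto simp: complete_edges_def)
    then show ?thesis
      unfolding graph_tree_def card_components_eq_1_iff[OF assms that]
      using acyclic_iff_bridged[of T] by simp
  qed
  then show ?thesis by (auto simp: spanning_trees_def)
qed

lemma finite_spanning_trees: "finite E \<Longrightarrow> finite (spanning_trees V E)"
  by (rule finite_subset[of _ "Pow E"]) (auto simp: spanning_trees_def)

section \<open>Double counting of spanning trees and their further edges\<close>

lemma card_ordered_pairs: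
  assumes "finite S" "\<And>e. e \<in> S \<Longrightarrow> card e = 2"
  shows "finite {(a, b). {a, b} \<in> S} \<and> card {(a, b). {a, b} \<in> S} = 2 * card S"
  using assms
proof (induction S rule: finite_induct)
  case (insert e S)
  then obtain a b where e: "e = {a, b}" "a \<noteq> b" by (metis card_2_iff insertI1)
  have "{(x, y). {x, y} \<in> insert e S} = {(a, b), (b, a)} \<union> {(x, y). {x, y} \<in> S}"
    unfolding e by (auto simp: doubleton_eq_iff)
  moreover have "{(a, b), (b, a)} \<inter> {(x, y). {x, y} \<in> S} = {}"
    using insert.hyps(2) by (auto simp: e insert_commute)
  moreover have "card {(a, b), (b, a)} = 2" using e(2) by simp
  ultimately show ?case using insert by (simp add: card_Un_disjoint del: Un_insert_left)
qed simp

text \<open>A connection inside \<open>F\<close> would bypass the edge \<open>{a, b}\<close> of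
  \<open>T\<close>, which is a bridge.\<close>

lemma bridged_extension_edge:
  assumes "bridged T" "F \<subseteq> T" "{a, b} \<in> T - F"
  shows "b \<notin> reach F a"
proof -
  have "reach F a \<subseteq> reach (T - {{a, b}}) a" using assms by (intro reach_mono) auto
  then show ?thesis using assms(1,3) unfolding bridged_def by blast
qed

text \<open>A component with \<open>s\<close> vertices contributes \<open>s\<close> times
  \<open>1/s\<close>.\<close>

lemma sum_inverse_component_size:
  assumes V: "finite V" and F: "F \<subseteq> complete_edges V"
  shows "(\<Sum>b\<in>V. 1 / real (card (reach F b))) = real (card (graph_components V F))"
proof -
  have "(\<Sum>b\<in>V. 1 / real (card (reach F b))) =
      (\<Sum>C\<in>reach F ` V. \<Sum>b\<in>{x \<in> V. reach F x = C}. 1 / real (card (reach F b)))"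
    by (rule sum.image_gen[OF V])
  also have "\<dots> = (\<Sum>C\<in>reach F ` V. 1)"
  proof (rule sum.cong[OF refl])
    fix C assume "C \<in> reach F ` V"
    then obtain x where x: "x \<in> V" "C = reach F x" by auto
    have C: "{y \<in> V. reach F y = C} = C"
      using x reach_subset_vertices[OF F x(1)] by (auto simp: reach_eq_iff reach_sym) 
    have "finite C" using x reach_subset_vertices[OF F x(1)] V finite_subset by blast
    moreover have "x \<in> C" using x(2) by simp
    ultimately have "card C > 0" by (auto simp: card_gt_0_iff)
    have "(\<Sum>b\<in>{y \<in> V. reach F y = C}. 1 / real (card (reach F b))) =
        (\<Sum>b\<in>{y \<in> V. reach F y = C}. 1 / real (card C))" by (intro sum.cong refl) simp
    also have "\<dots> = 1" unfolding C using \<open>card C > 0\<close> by simp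
    finally show "(\<Sum>b\<in>{y \<in> V. reach F y = C}. 1 / real (card (reach F b))) = 1" .
  qed
  finally show ?thesis by (simp add: graph_components_def)
qed

lemma sum_inverse_outside:
  assumes V: "finite V" and F: "F \<subseteq> complete_edges V" and a: "a \<in> V"
  shows "(\<Sum>b\<in>V - reach F a. 1 / real (card (reach F b))) = real (card (graph_components V F)) - 1"
proof -
  have sub: "reach F a \<subseteq> V" by (rule reach_subset_vertices[OF F a])
  have "(\<Sum>b\<in>reach F a. 1 / real (card (reach F b))) = (\<Sum>b\<in>reach F a. 1 / real (card (reach F a)))"
    by (intro sum.cong refl) (metis reach_eq_iff)
  also have "\<dots> = 1"
    using finite_subset[OF sub V] reach_refl[of a F] by (auto simp: card_eq_0_iff simp del: reach_refl)
  finally show ?thesis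
    using sum_diff[OF V sub, of "\<lambda>b. 1 / real (card (reach F b))"] sum_inverse_component_size[OF V F]
    by simp
qed

definition trees_containing :: "'v set \<Rightarrow> 'v set set \<Rightarrow> 'v set set set" where
  "trees_containing V F = {T \<in> spanning_trees V (complete_edges V). F \<subseteq> T}"

text \<open>Both sides count spanning trees \<open>T\<close> above \<open>F\<close> together with an
  ordered pair \<open>(a, b)\<close> such that \<open>{a, b}\<close> is in \<open>T - F\<close>. The
  factor 2 is the orientation, and \<open>card_forest\<close> for \<open>T\<close> and for
  \<open>F\<close> shows that \<open>T - F\<close> has one edge less than \<open>F\<close> has
  components.\<close>

lemma double_count_trees:
  assumes V: "finite V" and F: "F \<subseteq> complete_edges V" and br: "bridged F"
  shows "(\<Sum>a\<in>V. \<Sum>b\<in>V - reach F a. real (card (trees_containing V (insert {a, b} F)))) =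
    2 * (real (card (graph_components V F)) - 1) * real (card (trees_containing V F))"
proof -
  let ?S = "trees_containing V F" and ?k = "card (graph_components V F)"
  let ?D = "SIGMA a:V. V - reach F a"
  have finS: "finite ?S"
    using finite_spanning_trees[OF finite_complete_edges[OF V]] by (simp add: trees_containing_def)
  have finD: "finite ?D" using V by simp
  have each: "real (card {p \<in> ?D. {fst p, snd p} \<in> T}) = 2 * (real ?k - 1)" if T: "T \<in> ?S" for T
  proof -
    have TE: "T \<subseteq> complete_edges V" and c1: "card (graph_components V T) = 1" and brT: "bridged T"
      and FT: "F \<subseteq> T"
      using T by (auto simp: trees_containing_def spanning_trees_complete[OF V])
    have finT: "finite T" using TE finite_complete_edges[OF V] finite_subset by blast
    \<comment> \<open>Edges of \<open>F\<close> have both ends in one component of \<open>F\<close>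
      and edges of \<open>T - F\<close> never do, so \<open>?D\<close> selects exactly the
      orientations of \<open>T - F\<close>.\<close>
    have "{p \<in> ?D. {fst p, snd p} \<in> T} = {(a, b). {a, b} \<in> T - F}"
      using bridged_extension_edge[OF brT FT] reach_edge[of _ _ F] TE
      by (fastforce simp: subset_iff)
    also have "card \<dots> = 2 * card (T - F)"
      using card_ordered_pairs[of "T - F"] finT TE by (auto simp: complete_edges_def)
    finally have "card {p \<in> ?D. {fst p, snd p} \<in> T} = 2 * card (T - F)" .
    moreover have "card (T - F) + card F = card T"
      using FT finT by (metis card_mono card_Diff_subset finite_subset le_add_diff_inverse2)
    moreover have "card T + 1 = card V" using card_forest[OF V TE brT] c1 by simp
    moreover have "card F + ?k = card V" by (rule card_forest[OF V F br])
    ultimately have "card {p \<in> ?D. {fst p, snd p} \<in> T} + 2 = 2 * ?k" by linarith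
    then have "real (card {p \<in> ?D. {fst p, snd p} \<in> T} + 2) = real (2 * ?k)" by (rule arg_cong)
    then show ?thesis by simp
  qed
  have "(\<Sum>a\<in>V. \<Sum>b\<in>V - reach F a. real (card (trees_containing V (insert {a, b} F)))) =
      (\<Sum>p\<in>?D. real (card (trees_containing V (insert {fst p, snd p} F))))"
    using V by (subst sum.Sigma) (auto intro!: sum.cong)
  also have "\<dots> = (\<Sum>p\<in>?D. \<Sum>T\<in>?S. if {fst p, snd p} \<in> T then 1 else 0)"
  proof (rule sum.cong[OF refl])
    fix p
    have "trees_containing V (insert {fst p, snd p} F) = {T \<in> ?S. {fst p, snd p} \<in> T}"
      by (auto simp: trees_containing_def)
    then show "real (card (trees_containing V (insert {fst p, snd p} F))) =
        (\<Sum>T\<in>?S. if {fst p, snd p} \<in> T then 1 else 0)"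
      using finS by (simp add: sum.If_cases Int_def)
  qed
  also have "\<dots> = (\<Sum>T\<in>?S. \<Sum>p\<in>?D. if {fst p, snd p} \<in> T then 1 else 0)"
    by (rule sum.swap)
  also have "\<dots> = (\<Sum>T\<in>?S. 2 * (real ?k - 1))"
  proof (rule sum.cong[OF refl])
    fix T assume "T \<in> ?S"
    have "(\<Sum>p\<in>?D. if {fst p, snd p} \<in> T then 1 else 0) = real (card {p \<in> ?D. {fst p, snd p} \<in> T})"
      using finD by (simp add: sum.If_cases Int_def)
    then show "(\<Sum>p\<in>?D. if {fst p, snd p} \<in> T then 1 else 0) = 2 * (real ?k - 1)"
      using each[OF \<open>T \<in> ?S\<close>] by simp
  qed
  finally show ?thesis by simp
qed

text \<open>Multiplying by the square of \<open>card V\<close> turns the exponent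
  \<open>k - 2\<close> into \<open>k\<close> for \<open>k\<close> components, so the base case
  \<open>k = 1\<close> involves no negative power.\<close>

lemma card_trees_containing:
  assumes V: "finite V" "V \<noteq> {}" and F: "F \<subseteq> complete_edges V" and br: "bridged F"
  shows "real (card V) ^ 2 * real (card (trees_containing V F)) =
    real (card V) ^ card (graph_components V F) * component_weight V F"
  using F br
proof (induction "card (graph_components V F)" arbitrary: F rule: less_induct)
  case less
  note F = less.prems(1) and br = less.prems(2)
  let ?k = "card (graph_components V F)" and ?n = "real (card V)"
  have "?k \<noteq> 0" using V by (simp add: graph_components_def)
  show ?case
  proof (cases "?k = 1")
    case True
    \<comment> \<open>With one component \<open>F\<close> is already a spanning tree, and all
      spanning trees have equally many edges.\<close>
    have "T = F" if "T \<in> trees_containing V F" for T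
    proof -
      have T: "T \<subseteq> complete_edges V" "card (graph_components V T) = 1" "bridged T" "F \<subseteq> T"
        using that by (auto simp: trees_containing_def spanning_trees_complete[OF V(1)])
      have "card T = card F"
        using card_forest[OF V(1) T(1,3)] card_forest[OF V(1) F br] T(2) True by simp
      moreover have "finite T" using T(1) finite_complete_edges[OF V(1)] finite_subset by blast
      ultimately show ?thesis using T(4) card_subset_eq by metis
    qed
    moreover have "F \<in> trees_containing V F"
      using F br True by (simp add: trees_containing_def spanning_trees_complete[OF V(1)])
    ultimately have one: "trees_containing V F = {F}" by blast
    obtain C where C: "graph_components V F = {C}" using True by (auto simp: card_1_singleton_iff)
    have "C = V"
    proof -
      have "C \<in> reach F ` V" using C by (simp add: graph_components_def)
      then obtain x where "x \<in> V" "C = reach F x" by blast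
      then have "C \<subseteq> V" using reach_subset_vertices[OF F] by blast
      moreover have "V \<subseteq> C"
      proof
        fix v assume "v \<in> V"
        then have "reach F v \<in> {C}" unfolding C[symmetric] by (simp add: graph_components_def)
        then show "v \<in> C" using reach_refl[of v F] by simp
      qed
      ultimately show ?thesis by blast
    qed
    then show ?thesis using one C by (simp add: component_weight_def power2_eq_square)
  next
    case False
    let ?w = "component_weight V F"
    let ?r = "\<lambda>a. 1 / real (card (reach F a))"
    have IH: "?n ^ 2 * real (card (trees_containing V (insert {a, b} F))) =
        ?n ^ (?k - 1) * ?w * (?r a + ?r b)" if "a \<in> V" "b \<in> V - reach F a" for a b
    proof -
      have nr: "b \<in> V" "b \<notin> reach F a" using that by auto
      then have "a \<noteq> b" by auto
      then have E: "insert {a, b} F \<subseteq> complete_edges V" using F that by simp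
      have c: "?k = Suc (card (graph_components V (insert {a, b} F)))"
        by (rule card_components_insert[OF V(1) F that(1) nr])
      show ?thesis
        using less.hyps[OF _ E bridged_insert[OF br nr(2)]] c
          component_weight_insert[OF V(1) F that(1) nr] by simp
    qed
    \<comment> \<open>Lying in different components is symmetric, so both reciprocals in the weight
      factor have the same total.\<close>
    have swap: "(\<Sum>a\<in>V. \<Sum>b\<in>V - reach F a. ?r a) = (\<Sum>a\<in>V. \<Sum>b\<in>V - reach F a. ?r b)"
    proof -
      have "(\<Sum>a\<in>V. \<Sum>b\<in>V - reach F a. ?r a) = (\<Sum>b\<in>V. \<Sum>a\<in>{a\<in>V. b \<in> V - reach F a}. ?r a)"
        using sum.swap_restrict[OF V(1) V(1), of "\<lambda>a b. ?r a" "\<lambda>a b. b \<in> V - reach F a"]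
        by (simp add: set_diff_eq)
      also have "\<dots> = (\<Sum>b\<in>V. \<Sum>a\<in>V - reach F b. ?r a)"
        by (intro sum.cong) (auto dest: reach_sym)
      finally show ?thesis .
    qed
    have "2 * (real ?k - 1) * (?n ^ 2 * real (card (trees_containing V F))) =
       (\<Sum>a\<in>V. \<Sum>b\<in>V - reach F a. ?n ^ 2 * real (card (trees_containing V (insert {a, b} F))))"
      using double_count_trees[OF V(1) F br] by (simp add: sum_distrib_left[symmetric])
    also have "\<dots> = (\<Sum>a\<in>V. \<Sum>b\<in>V - reach F a. ?n ^ (?k - 1) * ?w * (?r a + ?r b))"
      by (intro sum.cong refl) (rule IH)
    also have "\<dots> = ?n ^ (?k - 1) * ?w * (2 * (\<Sum>a\<in>V. \<Sum>b\<in>V - reach F a. ?r b))"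
      using swap by (simp only: sum_distrib_left[symmetric] sum.distrib) simp
    also have "(\<Sum>a\<in>V. \<Sum>b\<in>V - reach F a. ?r b) = ?n * (real ?k - 1)"
      using sum_inverse_outside[OF V(1) F] by simp
    \<comment> \<open>For each \<open>a\<close> the reciprocals sum to \<open>k - 1\<close>, the
      same factor that the double count produces; it cancels because \<open>k \<noteq> 1\<close> in
      this case.\<close>
    finally have "2 * (real ?k - 1) * (?n ^ 2 * real (card (trees_containing V F))) =
        2 * (real ?k - 1) * (?n * ?n ^ (?k - 1) * ?w)" by (simp add: algebra_simps)
    moreover have "real ?k - 1 \<noteq> 0" using False by simp
    moreover have "?n * ?n ^ (?k - 1) = ?n ^ ?k"
      using \<open>?k \<noteq> 0\<close> by (metis Suc_pred' neq0_conv power_Suc)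
    ultimately show ?thesis by simp
  qed
qed

section \<open>The Hessian of the Kirchhoff polynomial\<close>

lemma two_edge_cases:
  assumes "e \<in> complete_edges V" "f \<in> complete_edges V" "e \<noteq> f"
  obtains (adjacent) a b c where "e = {b, a}" "f = {b, c}" "a \<noteq> b" "b \<noteq> c" "a \<noteq> c" "card (e \<inter> f) = 1"
    | (disjoint) a b c d where "e = {a, b}" "f = {c, d}" "a \<noteq> b" "c \<noteq> d" "a \<noteq> c" "a \<noteq> d" "b \<noteq> c" "b \<noteq> d"
        "card (e \<inter> f) = 0"
proof (cases "e \<inter> f = {}")
  case True
  obtain a b where e: "a \<noteq> b" "e = {a, b}" using assms(1) by (rule complete_edges_E)
  obtain c d where f: "c \<noteq> d" "f = {c, d}" using assms(2) by (rule complete_edges_E)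
  have "card (e \<inter> f) = 0" using True by simp
  moreover have "a \<noteq> c" "a \<noteq> d" "b \<noteq> c" "b \<noteq> d" using True e f by auto
  ultimately show ?thesis using disjoint e f by blast
next
  case False
  then obtain b where b: "b \<in> e" "b \<in> f" by blast
  have "\<exists>a. a \<noteq> b \<and> e = {b, a}" using complete_edges_E[OF assms(1)] b(1) by (metis empty_iff insert_commute insert_iff)
  then obtain a where a: "a \<noteq> b" "e = {b, a}" by blast
  have "\<exists>c. c \<noteq> b \<and> f = {b, c}" using complete_edges_E[OF assms(2)] b(2) by (metis empty_iff insert_commute insert_iff)
  then obtain c where c: "c \<noteq> b" "f = {b, c}" by blast
  have "a \<noteq> c" using a c assms(3) by blast
  then have "e \<inter> f = {b}" using a c by auto
  then have "card (e \<inter> f) = 1" by simp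
  then show ?thesis using adjacent[of b a c] a c \<open>a \<noteq> c\<close> by blast
qed

text \<open>The forest \<open>{e, f}\<close> has \<open>card V - 2\<close> components, whose sizes
  multiply to 3 if the edges share a vertex and to 4 if they are disjoint. On the left, a square
  comes from \<open>card_trees_containing\<close> and another from the two components lost.\<close>

lemma card_trees_two_edges:
  assumes V: "finite V" and ef: "e \<in> complete_edges V" "f \<in> complete_edges V" "e \<noteq> f"
  shows "real (card V) ^ 4 * real (card (trees_containing V {e, f})) =
    real (card V) ^ card V * (4 - real (card (e \<inter> f)))"
proof -
  have ne: "V \<noteq> {}" using ef(1) by (auto simp: complete_edges_def)
  \<comment> \<open>The first edge gives weight 2. Joining \<open>c\<close> to \<open>d\<close> then
    gives \<open>2 (1/2 + 1) = 3\<close> if one of them lies on the first edge and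
    \<open>2 (1 + 1) = 4\<close> if neither does.\<close>
  have step: "real (card V) ^ 4 * real (card (trees_containing V {{a, b}, {c, d}})) =
      real (card V) ^ card V * (2 * (1 / real (card (reach {{a, b}} c)) + 1 / real (card (reach {{a, b}} d))))"
    if "a \<in> V" "b \<in> V" "a \<noteq> b" "c \<in> V" "d \<in> V" "d \<notin> reach {{a, b}} c" for a b c d
  proof -
    have b1: "bridged {{a, b}}" using bridged_insert[of "{}" b a] that by (simp add: bridged_def)
    have E1: "{{a, b}} \<subseteq> complete_edges V" using that by simp
    have "component_weight V {} = 1"
      unfolding component_weight_def graph_components_def by (intro prod.neutral) auto
    then have w1: "component_weight V {{a, b}} = 2"
      using component_weight_insert[OF V, of "{}" a b] that by simp
    have k0: "card (graph_components V {}) = card V"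
      using card_forest[OF V, of "{}"] by (simp add: bridged_def)
    then have k1: "card V = Suc (card (graph_components V {{a, b}}))"
      using card_components_insert[OF V, of "{}" a b] that by simp
    have b2: "bridged (insert {c, d} {{a, b}})" by (rule bridged_insert[OF b1 that(6)])
    have "c \<noteq> d" using that by auto
    then have E2: "insert {c, d} {{a, b}} \<subseteq> complete_edges V" using that by simp
    have w2: "component_weight V (insert {c, d} {{a, b}}) =
       2 * (1 / real (card (reach {{a, b}} c)) + 1 / real (card (reach {{a, b}} d)))"
      using component_weight_insert[OF V E1 that(4-6)] w1 by simp
    have k2: "card V = Suc (Suc (card (graph_components V (insert {c, d} {{a, b}}))))"
      using card_components_insert[OF V E1 that(4-6)] k1 by simp
    have "real (card V) ^ card V =
       real (card V) ^ 2 * real (card V) ^ card (graph_components V (insert {c, d} {{a, b}}))"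
      by (subst (2) k2) (simp add: power2_eq_square)
    moreover have "real (card V) ^ 4 = real (card V) ^ 2 * real (card V) ^ 2"
      by (simp flip: power_add)
    ultimately show ?thesis
      using card_trees_containing[OF V ne E2 b2, unfolded w2]
      by (simp only: mult.assoc insert_commute[of "{a, b}" "{c, d}"])
  qed
  from ef show ?thesis
  proof (cases rule: two_edge_cases)
    case (adjacent a b c)
    have in_V: "a \<in> V" "b \<in> V" "c \<in> V" using ef adjacent by auto
    have r: "reach {{b, a}} b = {b, a}" "reach {{b, a}} c = {c}"
      using adjacent by (auto simp: reach_insert)
    show ?thesis
      using step[of b a b c] in_V adjacent r by simp
  next
    case (disjoint a b c d)
    have in_V: "a \<in> V" "b \<in> V" "c \<in> V" "d \<in> V" using ef disjoint by auto
    have r: "reach {{a, b}} c = {c}" "reach {{a, b}} d = {d}"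
      using disjoint by (auto simp: reach_insert)
    show ?thesis
      using step[of a b c d] in_V disjoint r by simp
  qed
qed

text \<open>Each summand is affine in \<open>x e\<close>, so the derivative keeps the products
  containing \<open>e\<close> and drops that factor. The family \<open>g\<close> allows a second
  application, to the sets \<open>T - {f}\<close>.\<close>

lemma partial_deriv_sum_prod:
  fixes g :: "'t \<Rightarrow> 'e set"
  assumes "finite S" "\<And>T. T \<in> S \<Longrightarrow> finite (g T)"
  shows "partial_deriv e (\<lambda>x. \<Sum>T\<in>S. \<Prod>f\<in>g T. x f) =
    (\<lambda>x. \<Sum>T\<in>{T \<in> S. e \<in> g T}. \<Prod>f\<in>g T - {e}. x f)"
proof
  fix x :: "'e \<Rightarrow> real"
  have prod: "(\<Prod>f\<in>g T. (x(e := t)) f) =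
      t * (if e \<in> g T then \<Prod>f\<in>g T - {e}. x f else 0) + (if e \<in> g T then 0 else \<Prod>f\<in>g T. x f)"
    if "T \<in> S" for T t
  proof (cases "e \<in> g T")
    case True
    have "(\<Prod>f\<in>g T - {e}. (x(e := t)) f) = (\<Prod>f\<in>g T - {e}. x f)"
      by (rule prod.cong) auto
    then show ?thesis
      using True prod.remove[OF assms(2)[OF that] True, of "x(e := t)"] by simp
  next
    case False
    then have "(\<Prod>f\<in>g T. (x(e := t)) f) = (\<Prod>f\<in>g T. x f)" by (intro prod.cong) auto
    then show ?thesis using False by simp
  qed
  let ?A = "\<Sum>T\<in>S. if e \<in> g T then \<Prod>f\<in>g T - {e}. x f else 0"
  let ?B = "\<Sum>T\<in>S. if e \<in> g T then 0 else \<Prod>f\<in>g T. x f"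
  have eq: "(\<lambda>t. \<Sum>T\<in>S. \<Prod>f\<in>g T. (x(e := t)) f) = (\<lambda>t. t * ?A + ?B)"
    by (rule ext) (simp add: prod sum.distrib sum_distrib_left del: fun_upd_apply)
  have "((\<lambda>t. t * ?A + ?B) has_field_derivative ?A) (at (x e))"
    by (auto intro!: derivative_eq_intros)
  then have "partial_deriv e (\<lambda>x. \<Sum>T\<in>S. \<Prod>f\<in>g T. x f) x = ?A"
    unfolding partial_deriv_def eq by (rule DERIV_imp_deriv)
  also have "\<dots> = (\<Sum>T\<in>{T \<in> S. e \<in> g T}. \<Prod>f\<in>g T - {e}. x f)"
    using assms(1) by (simp add: sum.inter_filter)
  finally show "partial_deriv e (\<lambda>x. \<Sum>T\<in>S. \<Prod>f\<in>g T. x f) x =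
      (\<Sum>T\<in>{T \<in> S. e \<in> g T}. \<Prod>f\<in>g T - {e}. x f)" .
qed

text \<open>The second derivative acts on products over \<open>T - {f}\<close>. For
  \<open>e = f\<close> none of them contains \<open>e\<close>; otherwise each remaining product is 1
  at the all-ones point.\<close>

lemma second_partial_kirchhoff_at_one:
  assumes E: "finite E"
  shows "partial_deriv e (partial_deriv f (kirchhoff_poly V E)) (\<lambda>_. 1) =
    (if e = f then 0 else real (card {T \<in> spanning_trees V E. {e, f} \<subseteq> T}))"
proof -
  let ?S = "spanning_trees V E"
  have finS: "finite ?S" by (rule finite_spanning_trees[OF E])
  have finT: "finite T" if "T \<in> ?S" for T
    using that E finite_subset by (auto simp: spanning_trees_def)
  have "partial_deriv f (kirchhoff_poly V E) = (\<lambda>x. \<Sum>T\<in>{T \<in> ?S. f \<in> T}. \<Prod>h\<in>T - {f}. x h)"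
    using partial_deriv_sum_prod[of ?S "\<lambda>T. T" f] finS finT
    unfolding kirchhoff_poly_def[abs_def] by simp
  moreover have "partial_deriv e (\<lambda>x. \<Sum>T\<in>{T \<in> ?S. f \<in> T}. \<Prod>h\<in>T - {f}. x h) =
      (\<lambda>x. \<Sum>T\<in>{T \<in> {T \<in> ?S. f \<in> T}. e \<in> T - {f}}. \<Prod>h\<in>T - {f} - {e}. x h)"
    by (rule partial_deriv_sum_prod) (use finS finT in auto)
  moreover have "{T \<in> {T \<in> ?S. f \<in> T}. e \<in> T - {f}} =
      (if e = f then {} else {T \<in> ?S. {e, f} \<subseteq> T})" by auto
  ultimately show ?thesis by simp
qed

text \<open>The extra 2 lets one formula serve the diagonal, where the intersection has 2 elements
  and the entry is 0. The exponent is an integer because it is -1 for \<open>n = 3\<close>.\<close>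

lemma hessian_complete_graph_entry:
  assumes V: "finite V" "card V = n" "n \<ge> 3" and es: "set es = complete_edges V" "distinct es"
    and ij: "i < length es" "j < length es"
  shows "hessian_mat_at_one V es $$ (i, j) =
    real n powi (int n - 4) * (4 - (if i = j then 2 else 0) - real (card (es ! i \<inter> es ! j)))"
proof -
  have mem: "es ! i \<in> complete_edges V" "es ! j \<in> complete_edges V" using es ij nth_mem by metis+
  have entry: "hessian_mat_at_one V es $$ (i, j) =
      (if es ! i = es ! j then 0 else real (card (trees_containing V {es ! i, es ! j})))"
    using ij second_partial_kirchhoff_at_one[OF finite_complete_edges[OF V(1)]]
    by (simp add: hessian_mat_at_one_def hessian_mat_def es(1) trees_containing_def)
  show ?thesis
  proof (cases "i = j")
    case True
    have "card (es ! j) = 2" using mem by (simp add: complete_edges_def)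
    then show ?thesis using entry True by simp
  next
    case False
    then have ne: "es ! i \<noteq> es ! j" using es(2) ij nth_eq_iff_index_eq by blast
    have n0: "real n \<noteq> 0" using V by simp
    have "real n powi (int n - 4) * real n ^ 4 = real n ^ n"
      using n0 power_int_add[of "real n" "int n - 4" 4] by simp
    then have "real n ^ 4 * real (card (trees_containing V {es ! i, es ! j})) =
       real n ^ 4 * (real n powi (int n - 4) * (4 - real (card (es ! i \<inter> es ! j))))"
      using card_trees_two_edges[OF V(1) mem ne] V(2) by (simp add: mult_ac)
    then show ?thesis using entry ne n0 False by simp
  qed
qed

section \<open>Dimensions of matrix kernels\<close>

lemma linear_map_mult_mat_vec:
  fixes A :: "'a :: field mat"
  assumes A: "A \<in> carrier_mat nr nc"
  shows "linear_map class_ring (module_vec TYPE('a) nc) (module_vec TYPE('a) nr) ((*\<^sub>v) A)"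
proof -
  interpret N: vec_space "TYPE('a)" nc .
  interpret R: vec_space "TYPE('a)" nr .
  show ?thesis
    using A by unfold_locales (auto simp: LinearCombinations.module_hom_def
        mult_add_distrib_mat_vec[OF A] mult_mat_vec[OF A] module_vec_simps)
qed

text \<open>Rank-nullity with full image; the additive form also yields
  \<open>nr \<le> nc\<close>.\<close>

lemma kernel_dim_surj:
  fixes A :: "'a :: field mat"
  assumes A: "A \<in> carrier_mat nr nc"
    and surj: "\<And>w. w \<in> carrier_vec nr \<Longrightarrow> \<exists>v \<in> carrier_vec nc. A *\<^sub>v v = w"
  shows "kernel_dim A + nr = nc"
proof -
  interpret N: vec_space "TYPE('a)" nc .
  interpret R: vec_space "TYPE('a)" nr .
  interpret T: linear_map class_ring "module_vec TYPE('a) nc" "module_vec TYPE('a) nr" "(*\<^sub>v) A"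
    by (rule linear_map_mult_mat_vec[OF A])
  interpret K: kernel nr nc A by unfold_locales (rule A)
  have im: "T.imT = carrier (module_vec TYPE('a) nr)"
    using surj A by (fastforce simp: T.im_def module_vec_simps)
  have ker: "T.kerT = mat_kernel A"
    using A by (auto simp: T.ker_def mat_kernel_def module_vec_simps)
  show ?thesis
    using T.rank_nullity[OF N.fin_dim] unfolding im ker N.dim_is_n K.kernel_dim
    using R.dim_is_n by (simp add: module_vec_def)
qed

text \<open>A linear bijection preserves dimension. Each eigenspace is compared in this way with the
  kernel of a simpler matrix.\<close>

lemma kernel_dim_cong_bij:
  fixes A B Q :: "'a :: field mat"
  assumes A: "A \<in> carrier_mat nr nc" and B: "B \<in> carrier_mat mr mc" and Q: "Q \<in> carrier_mat mc nc"
    and bij: "bij_betw ((*\<^sub>v) Q) (mat_kernel A) (mat_kernel B)"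
  shows "kernel_dim A = kernel_dim B"
proof -
  interpret KA: kernel nr nc A by unfold_locales (rule A)
  interpret KB: kernel mr mc B by unfold_locales (rule B)
  have mem: "v \<in> carrier_vec nc" if "v \<in> mat_kernel A" for v
    using that mat_kernel[OF A] by auto
  interpret T: linear_map class_ring KA.VK KB.VK "(*\<^sub>v) Q"
    using bij by unfold_locales (auto simp: LinearCombinations.module_hom_def
        mult_add_distrib_mat_vec[OF Q] mult_mat_vec[OF Q] bij_betw_def mem)
  have fd: "KA.Ker.fin_dim"
    using kernel_basis_exists[OF A] unfolding KA.Ker.fin_dim_def KA.Ker.basis_def by blast
  show ?thesis
    using T.dim_eq[OF fd] bij by (simp add: bij_betw_def)
qed

text \<open>An eigenvalue means a nonzero vector in this kernel, and a kernel is zero exactly when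
  its finite basis is empty.\<close>

lemma eigenvalue_iff_kernel_dim:
  fixes A :: "'a :: field mat"
  assumes A: "A \<in> carrier_mat n n"
  shows "eigenvalue A k \<longleftrightarrow> kernel_dim (char_matrix A k) \<noteq> 0"
proof -
  let ?C = "char_matrix A k"
  have C: "?C \<in> carrier_mat n n" using A by simp
  interpret K: kernel n n ?C by unfold_locales (rule C)
  obtain B where B: "finite B" "K.basis B" using kernel_basis_exists[OF C] by blast
  have "K.dim = 0 \<longleftrightarrow> B = {}" using K.Ker.dim_basis[OF B] B(1) by simp
  also have "\<dots> \<longleftrightarrow> mat_kernel ?C = {0\<^sub>v n}"
  proof
    assume "B = {}"
    then show "mat_kernel ?C = {0\<^sub>v n}"
      using B(2) K.Ker.span_empty unfolding K.Ker.basis_def by simp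
  next
    assume "mat_kernel ?C = {0\<^sub>v n}"
    then have "B \<subseteq> {0\<^sub>v n}" using B(2) unfolding K.Ker.basis_def by simp
    moreover have "(UNIV :: 'a set) \<noteq> {0}"
      by (metis UNIV_I singletonD zero_neq_one)
    then have "0\<^sub>v n \<notin> B"
      using B(2) K.Ker.zero_nin_lin_indpt[of B] unfolding K.Ker.basis_def by blast
    ultimately show "B = {}" by auto
  qed
  also have "\<dots> \<longleftrightarrow> \<not> eigenvalue A k"
  proof -
    have "?C *\<^sub>v 0\<^sub>v n = 0\<^sub>v n" using C by (intro eq_vecI) (auto simp del: char_matrix_closed)
    then show ?thesis unfolding eigenvalue_char_matrix[OF A] mat_kernel[OF C] by auto
  qed
  finally show ?thesis by simp
qed

section \<open>Spectrum\<close>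

locale complete_graph_enumeration =
  fixes V :: "'v set" and vs :: "'v list" and es :: "'v set list" and n m :: nat
  assumes distinct_vs: "distinct vs" and set_vs: "set vs = V" and length_vs: "length vs = n"
    and distinct_es: "distinct es" and set_es: "set es = complete_edges V" and length_es: "length es = m"
    and n_ge_3: "n \<ge> 3"
begin

lemma finite_V: "finite V"
  unfolding set_vs[symmetric] by (rule finite_set)

lemma card_V: "card V = n"
  using distinct_card[OF distinct_vs] unfolding set_vs length_vs .

lemma edge: "i < m \<Longrightarrow> es ! i \<subseteq> V" "i < m \<Longrightarrow> card (es ! i) = 2" "i < m \<Longrightarrow> finite (es ! i)"
proof -
  assume "i < m"
  then have "es ! i \<in> complete_edges V" using set_es length_es nth_mem by metis
  then show "es ! i \<subseteq> V" "card (es ! i) = 2" "finite (es ! i)"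
    using finite_V by (auto simp: complete_edges_def intro: finite_subset)
qed

lemma sum_edges: "(\<Sum>i<m. f (es ! i)) = (\<Sum>e\<in>complete_edges V. f e)"
  using sum.reindex_bij_betw[OF bij_betw_nth[OF distinct_es refl refl], of f]
  unfolding set_es length_es .

lemma sum_vertices: "(\<Sum>j<n. f (vs ! j)) = (\<Sum>x\<in>V. f x)"
  using sum.reindex_bij_betw[OF bij_betw_nth[OF distinct_vs refl refl], of f]
  unfolding set_vs length_vs .

lemma m_eq: "m = n choose 2"
proof -
  have "m = card (complete_edges V)"
    using distinct_card[OF distinct_es] unfolding set_es length_es by (rule sym)
  also have "\<dots> = n choose 2"
    unfolding complete_edges_def n_subsets[OF finite_V] card_V ..
  finally show ?thesis .
qed

lemma of_nat_m: "2 * real m = real n * (real n - 1)"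
proof -
  have "2 * m = n * (n - 1)" unfolding m_eq choose_two by (intro dvd_mult_div_cancel) auto
  then have "real (2 * m) = real (n * (n - 1))" by (rule arg_cong)
  then show ?thesis using n_ge_3 by (simp add: of_nat_diff)
qed

text \<open>In the notation \<open>s\<close>, \<open>z\<close>, \<open>B\<close> of the introduction: \<open>s = total v\<close>, \<open>z = vertex_sum v\<close>,
  \<open>B g = edge_vec g\<close>.\<close>

definition total :: "real vec \<Rightarrow> real" where
  "total v = (\<Sum>i<m. v $ i)"

definition vertex_sum :: "real vec \<Rightarrow> 'v \<Rightarrow> real" where
  "vertex_sum v x = (\<Sum>i<m. if x \<in> es ! i then v $ i else 0)"

definition edge_vec :: "('v \<Rightarrow> real) \<Rightarrow> real vec" where
  "edge_vec g = vec m (\<lambda>i. \<Sum>x\<in>es ! i. g x)"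

lemma edge_vec_carrier [simp]: "edge_vec g \<in> carrier_vec m"
  by (simp add: edge_vec_def)

lemma sum_edge_eq: "i < m \<Longrightarrow> (\<Sum>x\<in>es ! i. g x) = (\<Sum>x\<in>V. if x \<in> es ! i then g x else 0)"
  using edge(1)[of i] by (simp add: sum.inter_restrict[OF finite_V, symmetric] Int_absorb1)

text \<open>Handshake argument: every edge is counted at its two ends.\<close>

lemma sum_vertex_sum: "(\<Sum>x\<in>V. vertex_sum v x) = 2 * total v"
proof -
  have "(\<Sum>x\<in>V. vertex_sum v x) = (\<Sum>i<m. \<Sum>x\<in>V. if x \<in> es ! i then v $ i else 0)"
    unfolding vertex_sum_def by (rule sum.swap)
  also have "\<dots> = (\<Sum>i<m. 2 * v $ i)"
    by (intro sum.cong refl) (simp add: sum_edge_eq[symmetric] edge(2))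
  finally show ?thesis by (simp add: total_def sum_distrib_left)
qed

text \<open>This is \<open>B\<^sup>T B = (n - 2) I + J\<close>. The edges at \<open>y\<close>
  correspond to the other vertices \<open>x\<close>, each contributing \<open>g x + g y\<close>; one
  of the \<open>n - 1\<close> copies of \<open>g y\<close> completes the sum over
  \<open>V\<close>.\<close>

lemma vertex_sum_edge_vec:
  assumes "y \<in> V"
  shows "vertex_sum (edge_vec g) y = (real n - 2) * g y + (\<Sum>x\<in>V. g x)"
proof -
  have "vertex_sum (edge_vec g) y = (\<Sum>i<m. if y \<in> es ! i then \<Sum>x\<in>es ! i. g x else 0)"
    unfolding vertex_sum_def by (intro sum.cong) (auto simp: edge_vec_def)
  also have "\<dots> = (\<Sum>e\<in>complete_edges V. if y \<in> e then \<Sum>x\<in>e. g x else 0)"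
    by (rule sum_edges)
  also have "\<dots> = (\<Sum>e\<in>{e \<in> complete_edges V. y \<in> e}. \<Sum>x\<in>e. g x)"
    using finite_complete_edges[OF finite_V] by (simp add: sum.inter_filter)
  also have "\<dots> = (\<Sum>x\<in>V - {y}. g x + g y)"
  proof -
    have bij: "bij_betw (\<lambda>x. {x, y}) (V - {y}) {e \<in> complete_edges V. y \<in> e}"
    proof (rule bij_betwI')
      fix e assume e: "e \<in> {e \<in> complete_edges V. y \<in> e}"
      then obtain a b where "a \<in> V" "b \<in> V" "a \<noteq> b" "e = {a, b}" using complete_edges_E by blast
      with e show "\<exists>x\<in>V - {y}. e = {x, y}" by auto
    qed (use assms in \<open>auto simp: doubleton_eq_iff\<close>)
    show ?thesis
      by (subst sum.reindex_bij_betw[OF bij, symmetric]) (auto intro!: sum.cong)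
  qed
  also have "\<dots> = (\<Sum>x\<in>V - {y}. g x) + (real n - 1) * g y"
    using assms finite_V n_ge_3 by (simp add: sum.distrib card_V of_nat_diff)
  also have "(\<Sum>x\<in>V - {y}. g x) = (\<Sum>x\<in>V. g x) - g y"
    using sum_diff1[OF finite_V, of g y] assms by simp
  finally show ?thesis by (simp add: algebra_simps)
qed

lemma total_edge_vec: "total (edge_vec g) = (real n - 1) * (\<Sum>x\<in>V. g x)"
proof -
  have "2 * total (edge_vec g) = (\<Sum>y\<in>V. (real n - 2) * g y + (\<Sum>x\<in>V. g x))"
    unfolding sum_vertex_sum[symmetric] by (intro sum.cong refl) (rule vertex_sum_edge_vec)
  also have "\<dots> = (real n - 2) * (\<Sum>x\<in>V. g x) + real n * (\<Sum>x\<in>V. g x)"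
    by (simp add: sum.distrib sum_distrib_left card_V)
  finally show ?thesis by (simp add: algebra_simps)
qed

section \<open>Incidence matrix and the matrix form of the Hessian\<close>

lemma vertex_fun_of_vec:
  assumes "w \<in> carrier_vec n"
  obtains g where "\<And>j. j < n \<Longrightarrow> g (vs ! j) = w $ j"
proof
  fix j assume "j < n"
  then show "(\<lambda>x. w $ (inv_into {..<n} ((!) vs) x)) (vs ! j) = w $ j"
    using bij_betw_nth[OF distinct_vs refl refl] length_vs by (simp add: bij_betw_def inv_into_f_f)
qed

definition incidence :: "real mat" where
  "incidence = mat m n (\<lambda>(i, j). if vs ! j \<in> es ! i then 1 else 0)"

lemma incidence_carrier [simp]: "incidence \<in> carrier_mat m n"
  by (simp add: incidence_def)

lemma incidence_mult:
  assumes "w \<in> carrier_vec n" "\<And>j. j < n \<Longrightarrow> g (vs ! j) = w $ j"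
  shows "incidence *\<^sub>v w = edge_vec g"
proof (rule eq_vecI)
  fix i assume "i < dim_vec (edge_vec g)"
  then have i: "i < m" by (simp add: edge_vec_def)
  have "(incidence *\<^sub>v w) $ i = (\<Sum>j<n. if vs ! j \<in> es ! i then g (vs ! j) else 0)"
    using i assms by (auto simp: incidence_def scalar_prod_def lessThan_atLeast0 intro!: sum.cong)
  also have "\<dots> = (\<Sum>x\<in>V. if x \<in> es ! i then g x else 0)"
    by (rule sum_vertices)
  finally show "(incidence *\<^sub>v w) $ i = edge_vec g $ i"
    using i by (simp add: edge_vec_def sum_edge_eq)
qed (simp add: incidence_def edge_vec_def)

lemma transpose_incidence_mult:
  assumes "v \<in> carrier_vec m" "j < n"
  shows "(transpose_mat incidence *\<^sub>v v) $ j = vertex_sum v (vs ! j)"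
proof -
  have "(transpose_mat incidence *\<^sub>v v) $ j = (\<Sum>i<m. (if vs ! j \<in> es ! i then 1 else 0) * v $ i)"
    using assms by (simp add: incidence_def scalar_prod_def lessThan_atLeast0)
  also have "\<dots> = vertex_sum v (vs ! j)"
    unfolding vertex_sum_def by (rule sum.cong) auto
  finally show ?thesis .
qed

text \<open>The matrix \<open>c (4J - 2I - B B\<^sup>T)\<close>, as the overlap of two edges is an
  entry of \<open>B B\<^sup>T\<close>. A nonzero \<open>c\<close> can be divided out once
  eigenvalues are written \<open>c * t\<close>, which keeps the power of \<open>n\<close> out of the
  computation.\<close>

definition overlap_mat :: "real \<Rightarrow> real mat" where
  "overlap_mat c = mat m m (\<lambda>(i, j).
     c * (4 - (if i = j then 2 else 0) - real (card (es ! i \<inter> es ! j))))"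

lemma overlap_mat_carrier [simp]: "overlap_mat c \<in> carrier_mat m m"
  by (simp add: overlap_mat_def)

lemma overlap_mat_mult:
  assumes v: "v \<in> carrier_vec m" and i: "i < m"
  shows "(overlap_mat c *\<^sub>v v) $ i =
    c * (4 * total v - 2 * v $ i - (\<Sum>x\<in>es ! i. vertex_sum v x))"
proof -
  \<comment> \<open>Counting common vertices one by one and exchanging the sums applies
    \<open>B B\<^sup>T\<close> as \<open>B\<close> after \<open>B\<^sup>T\<close>.\<close>
  have "(\<Sum>j<m. real (card (es ! i \<inter> es ! j)) * v $ j) =
      (\<Sum>j<m. \<Sum>x\<in>es ! i. if x \<in> es ! j then v $ j else 0)"
    using edge(3)[OF i] by (simp add: sum.If_cases Int_def)
  also have "\<dots> = (\<Sum>x\<in>es ! i. vertex_sum v x)"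
    unfolding vertex_sum_def by (rule sum.swap)
  finally have ov: "(\<Sum>j<m. real (card (es ! i \<inter> es ! j)) * v $ j) = (\<Sum>x\<in>es ! i. vertex_sum v x)" .
  have "(\<Sum>j<m. (if i = j then 2 else 0) * v $ j) = (\<Sum>j<m. if i = j then 2 * v $ j else 0)"
    by (intro sum.cong) auto
  also have "\<dots> = 2 * v $ i" using i by simp
  finally have diag: "(\<Sum>j<m. (if i = j then 2 else 0) * v $ j) = 2 * v $ i" .
  have "(overlap_mat c *\<^sub>v v) $ i =
     (\<Sum>j<m. c * (4 * v $ j - (if i = j then 2 else 0) * v $ j - real (card (es ! i \<inter> es ! j)) * v $ j))"
    using v i by (simp add: overlap_mat_def scalar_prod_def lessThan_atLeast0 algebra_simps)
  also have "\<dots> = c * (4 * total v - 2 * v $ i - (\<Sum>x\<in>es ! i. vertex_sum v x))"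
    by (simp only: sum_distrib_left[symmetric] sum_subtractf diag ov total_def)
  finally show ?thesis .
qed

section \<open>Linear relations satisfied by eigenvectors\<close>

lemma mem_eigenspace_iff:
  assumes "c \<noteq> 0"
  shows "v \<in> mat_kernel (char_matrix (overlap_mat c) (c * t)) \<longleftrightarrow> v \<in> carrier_vec m \<and>
    (\<forall>i<m. (t + 2) * v $ i = 4 * total v - (\<Sum>x\<in>es ! i. vertex_sum v x))"
proof -
  have C: "char_matrix (overlap_mat c) (c * t) \<in> carrier_mat m m" by simp
  have "char_matrix (overlap_mat c) (c * t) *\<^sub>v v = 0\<^sub>v m \<longleftrightarrow>
      (\<forall>i<m. (t + 2) * v $ i = 4 * total v - (\<Sum>x\<in>es ! i. vertex_sum v x))"
    if v: "v \<in> carrier_vec m"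
  proof -
    have "((- (c * t)) \<cdot>\<^sub>m 1\<^sub>m m) *\<^sub>v v = (- (c * t)) \<cdot>\<^sub>v v"
      using v by (intro eq_vecI) auto
    then have "char_matrix (overlap_mat c) (c * t) *\<^sub>v v = overlap_mat c *\<^sub>v v + (- (c * t)) \<cdot>\<^sub>v v"
      using v add_mult_distrib_mat_vec[OF overlap_mat_carrier, of "(- (c * t)) \<cdot>\<^sub>m 1\<^sub>m m" v c]
      by (simp add: char_matrix_def overlap_mat_def)
    then have "char_matrix (overlap_mat c) (c * t) *\<^sub>v v = 0\<^sub>v m \<longleftrightarrow>
        (\<forall>i<m. (overlap_mat c *\<^sub>v v) $ i = c * (t * v $ i))"
      using v by (auto simp: vec_eq_iff overlap_mat_def mult.assoc)
    also have "\<dots> \<longleftrightarrow> (\<forall>i<m. (t + 2) * v $ i = 4 * total v - (\<Sum>x\<in>es ! i. vertex_sum v x))"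
      using assms by (simp add: overlap_mat_mult[OF v]) (auto simp: algebra_simps)
    finally show ?thesis .
  qed
  then show ?thesis unfolding mat_kernel[OF C] by blast
qed

lemma eigenspace_vertex_sum:
  assumes c: "c \<noteq> 0" and v: "v \<in> mat_kernel (char_matrix (overlap_mat c) (c * t))" and y: "y \<in> V"
  shows "(t + real n) * vertex_sum v y = (4 * real n - 6) * total v"
proof -
  have eq: "(t + 2) * v $ i = 4 * total v - (\<Sum>x\<in>es ! i. vertex_sum v x)" if "i < m" for i
    using v that by (simp add: mem_eigenspace_iff[OF c])
  have "(t + 2) * vertex_sum v y = (\<Sum>i<m. if y \<in> es ! i then (t + 2) * v $ i else 0)"
    by (simp add: vertex_sum_def sum_distrib_left if_distrib cong: if_cong)
  \<comment> \<open>The term \<open>4 * total v\<close> is split evenly over the two ends of an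
    edge, so that the right-hand side is \<open>edge_vec\<close> of one vertex function and
    \<open>vertex_sum_edge_vec\<close> applies.\<close>
  also have "\<dots> = (\<Sum>i<m. if y \<in> es ! i then \<Sum>x\<in>es ! i. 2 * total v - vertex_sum v x else 0)"
    by (intro sum.cong refl) (simp add: eq sum_subtractf edge(2))
  also have "\<dots> = vertex_sum (edge_vec (\<lambda>x. 2 * total v - vertex_sum v x)) y"
    by (simp add: vertex_sum_def edge_vec_def cong: if_cong)
  also have "\<dots> = (real n - 2) * (2 * total v - vertex_sum v y) + (2 * real n * total v - 2 * total v)"
    by (simp add: vertex_sum_edge_vec[OF y] sum_subtractf sum_vertex_sum card_V)
  finally show ?thesis by (simp add: algebra_simps)
qed

text \<open>Summing \<open>eigenspace_vertex_sum\<close> over \<open>V\<close> turns the vertex sums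
  into \<open>2 * total v\<close>, and \<open>2 (t + n) = n (4n - 6)\<close> is equivalent to
  \<open>t = 2n (n - 2)\<close>.\<close>

lemma eigenspace_total:
  assumes "c \<noteq> 0" "v \<in> mat_kernel (char_matrix (overlap_mat c) (c * t))"
  shows "(t - 2 * real n * (real n - 2)) * total v = 0"
proof -
  have "(t + real n) * (2 * total v) = (\<Sum>y\<in>V. (t + real n) * vertex_sum v y)"
    by (simp add: sum_vertex_sum flip: sum_distrib_left)
  also have "\<dots> = (\<Sum>y\<in>V. (4 * real n - 6) * total v)"
    by (intro sum.cong refl) (rule eigenspace_vertex_sum[OF assms])
  also have "\<dots> = real n * ((4 * real n - 6) * total v)" by (simp add: card_V)
  finally show ?thesis by (simp add: algebra_simps)
qed

text \<open>The last exclusion on \<open>t\<close> makes the total vanish, then the second makes the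
  vertex sums vanish, and then the first the entries of \<open>v\<close>.\<close>

lemma eigenspace_trivial:
  assumes "c \<noteq> 0" "t \<noteq> -2" "t \<noteq> - real n" "t \<noteq> 2 * real n * (real n - 2)"
    and v: "v \<in> mat_kernel (char_matrix (overlap_mat c) (c * t))"
  shows "v = 0\<^sub>v m"
proof -
  have s: "total v = 0" using eigenspace_total[OF assms(1) v] assms(4) by simp
  have "t + real n \<noteq> 0" using assms(3) by linarith
  then have z: "vertex_sum v y = 0" if "y \<in> V" for y
    using eigenspace_vertex_sum[OF assms(1) v that] s by simp
  have v': "v \<in> carrier_vec m" using v by (simp add: mem_eigenspace_iff[OF assms(1)])
  have "t + 2 \<noteq> 0" using assms(2) by linarith
  have "v $ i = 0" if "i < m" for i
  proof -
    have "(\<Sum>x\<in>es ! i. vertex_sum v x) = 0" using z edge(1)[OF that] by (intro sum.neutral) auto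
    then have "(t + 2) * v $ i = 0" using v that s by (simp add: mem_eigenspace_iff[OF assms(1)])
    then show ?thesis using \<open>t + 2 \<noteq> 0\<close> by simp
  qed
  then show ?thesis using v' by auto
qed

section \<open>Dimensions of the three eigenspaces\<close>

lemma eigenspace_dim_minus_2:
  assumes c: "c \<noteq> 0"
  shows "kernel_dim (char_matrix (overlap_mat c) (c * (-2))) + n = m"
proof -
  let ?B = "transpose_mat incidence"
  have B: "?B \<in> carrier_mat n m" by simp
  have n2: "real n - 2 \<noteq> 0" "real n - 1 \<noteq> 0" using n_ge_3 by linarith+
  \<comment> \<open>For \<open>t = -2\<close> the entries of \<open>v\<close> drop out of the
    eigenvector equation, and the eigenspace is the kernel of the transposed incidence
    matrix.\<close>
  have "v \<in> mat_kernel ?B \<longleftrightarrow> v \<in> mat_kernel (char_matrix (overlap_mat c) (c * (-2)))" for v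
  proof
    assume "v \<in> mat_kernel ?B"
    then have v: "v \<in> carrier_vec m" "?B *\<^sub>v v = 0\<^sub>v n" using mat_kernelD[OF B] by auto
    have z: "vertex_sum v x = 0" if x: "x \<in> V" for x
    proof -
      obtain j where "j < n" "x = vs ! j" using x set_vs length_vs by (auto simp: in_set_conv_nth)
      then show ?thesis using transpose_incidence_mult[OF v(1)] v(2) by force
    qed
    then have "total v = 0" using sum_vertex_sum[of v] by simp
    moreover have "(\<Sum>x\<in>es ! i. vertex_sum v x) = 0" if "i < m" for i
      using z edge(1)[OF that] by (intro sum.neutral) auto
    ultimately show "v \<in> mat_kernel (char_matrix (overlap_mat c) (c * (-2)))"
      using v(1) by (simp only: mem_eigenspace_iff[OF c]) simp
  next
    assume v: "v \<in> mat_kernel (char_matrix (overlap_mat c) (c * (-2)))"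
    have v': "v \<in> carrier_vec m" using v mem_eigenspace_iff[OF c] by blast
    have "real n * (real n - 2) \<ge> 0" using n_ge_3 by (intro mult_nonneg_nonneg) auto
    then have "-2 - 2 * real n * (real n - 2) \<noteq> 0" by (simp add: mult.assoc)
    then have s: "total v = 0" using eigenspace_total[OF c v] by simp
    have z: "vertex_sum v y = 0" if "y \<in> V" for y
      using eigenspace_vertex_sum[OF c v that] s n2 by simp
    have "vs ! j \<in> V" if "j < n" for j using that set_vs length_vs nth_mem by metis
    then have "?B *\<^sub>v v = 0\<^sub>v n"
      using transpose_incidence_mult[OF v'] z by (intro eq_vecI) (auto simp: incidence_def)
    then show "v \<in> mat_kernel ?B" using v' by (intro mat_kernelI[OF B])
  qed
  then have ker: "mat_kernel ?B = mat_kernel (char_matrix (overlap_mat c) (c * (-2)))" by blast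
  have sub: "mat_kernel ?B \<subseteq> carrier_vec m" using mat_kernel[OF B] by auto
  \<comment> \<open>The kernels coincide, so the identity matrix transports the dimension.\<close>
  have "bij_betw ((*\<^sub>v) (1\<^sub>m m)) (mat_kernel ?B) (mat_kernel (char_matrix (overlap_mat c) (c * (-2))))"
    unfolding ker[symmetric] bij_betw_def
    using sub by (auto simp: inj_on_def image_iff subset_iff)
  then have "kernel_dim ?B = kernel_dim (char_matrix (overlap_mat c) (c * (-2)))"
    by (intro kernel_dim_cong_bij[OF B, of _ m m]) auto
  moreover have "kernel_dim ?B + n = m"
  proof (rule kernel_dim_surj[OF B])
    fix w :: "real vec" assume w: "w \<in> carrier_vec n"
    obtain g where g: "\<And>j. j < n \<Longrightarrow> g (vs ! j) = w $ j" using vertex_fun_of_vec[OF w] by blast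
    let ?W = "\<Sum>x\<in>V. g x"
    \<comment> \<open>This solves \<open>(n - 2) h + H = g\<close> with \<open>H\<close> the sum of
      \<open>h\<close>: summing over \<open>V\<close> gives \<open>2 (n - 1) H = W\<close> for the
      sum \<open>W\<close> of \<open>g\<close>. Hence the transposed incidence matrix is
      onto.\<close>
    define h where "h x = (g x - ?W / (2 * (real n - 1))) / (real n - 2)" for x
    have "(\<Sum>x\<in>V. h x) = (?W - real n * (?W / (2 * (real n - 1)))) / (real n - 2)"
      by (simp add: h_def sum_divide_distrib[symmetric] sum_subtractf card_V)
    also have "?W - real n * (?W / (2 * (real n - 1))) = (real n - 2) * (?W / (2 * (real n - 1)))"
      using n2 by (simp add: field_simps)
    finally have H: "(\<Sum>x\<in>V. h x) = ?W / (2 * (real n - 1))" using n2 by simp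
    have "vertex_sum (edge_vec h) y = g y" if "y \<in> V" for y
      unfolding vertex_sum_edge_vec[OF that] H using n2 by (simp add: h_def)
    moreover have "vs ! j \<in> V" if "j < n" for j using that set_vs length_vs nth_mem by metis
    ultimately have "(?B *\<^sub>v edge_vec h) $ j = w $ j" if "j < n" for j
      using that g by (simp add: transpose_incidence_mult)
    then have "?B *\<^sub>v edge_vec h = w"
      using w by (intro eq_vecI) (auto simp: incidence_def)
    then show "\<exists>v\<in>carrier_vec m. ?B *\<^sub>v v = w" by (auto simp: edge_vec_def)
  qed
  ultimately show ?thesis by simp
qed

text \<open>On functions with sum 0, \<open>B\<^sup>T B\<close> is multiplication by
  \<open>n - 2\<close>, so \<open>B\<close> is injective there, and its image is the eigenspace.
  These functions form the kernel of a single row of ones, of dimension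
  \<open>n - 1\<close>.\<close>

lemma eigenspace_dim_minus_n:
  assumes c: "c \<noteq> 0"
  shows "kernel_dim (char_matrix (overlap_mat c) (c * (- real n))) + 1 = n"
proof -
  let ?A = "mat 1 n (\<lambda>_. 1 :: real)"
  let ?K = "mat_kernel (char_matrix (overlap_mat c) (c * (- real n)))"
  have A: "?A \<in> carrier_mat 1 n" by simp
  have n2: "real n - 2 \<noteq> 0" "real n \<noteq> 0" "4 * real n - 6 \<noteq> 0" using n_ge_3 by auto
  have in_V: "vs ! j \<in> V" if "j < n" for j using that set_vs length_vs nth_mem by metis
  have A_mult: "?A *\<^sub>v w = 0\<^sub>v 1 \<longleftrightarrow> (\<Sum>x\<in>V. g x) = 0"
    if "w \<in> carrier_vec n" "\<And>j. j < n \<Longrightarrow> g (vs ! j) = w $ j" for w g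
    using that by (auto simp: vec_eq_iff scalar_prod_def lessThan_atLeast0 sum_vertices[symmetric])
  have "bij_betw ((*\<^sub>v) incidence) (mat_kernel ?A) ?K"
  proof (rule bij_betwI')
    fix w w' assume "w \<in> mat_kernel ?A" "w' \<in> mat_kernel ?A"
    then have w: "w \<in> carrier_vec n" "w' \<in> carrier_vec n" "?A *\<^sub>v w = 0\<^sub>v 1" "?A *\<^sub>v w' = 0\<^sub>v 1"
      using mat_kernelD[OF A] by blast+
    obtain g where g: "\<And>j. j < n \<Longrightarrow> g (vs ! j) = w $ j" using vertex_fun_of_vec[OF w(1)] by blast
    obtain g' where g': "\<And>j. j < n \<Longrightarrow> g' (vs ! j) = w' $ j" using vertex_fun_of_vec[OF w(2)] by blast
    have G: "(\<Sum>x\<in>V. g x) = 0" "(\<Sum>x\<in>V. g' x) = 0"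
      using A_mult[where g = g, OF w(1) g] A_mult[where g = g', OF w(2) g'] w by blast+
    show "(incidence *\<^sub>v w = incidence *\<^sub>v w') = (w = w')"
    proof
      assume "incidence *\<^sub>v w = incidence *\<^sub>v w'"
      then have "edge_vec g = edge_vec g'"
        using incidence_mult[where g = g, OF w(1) g] incidence_mult[where g = g', OF w(2) g'] by simp
      then have "(real n - 2) * g y = (real n - 2) * g' y" if "y \<in> V" for y
        using vertex_sum_edge_vec[OF that, of g] vertex_sum_edge_vec[OF that, of g'] G
        by (metis add.right_neutral)
      then have "g y = g' y" if "y \<in> V" for y using that n2 by simp
      then have "w $ j = w' $ j" if "j < n" for j using g[OF that] g'[OF that] in_V[OF that] by metis
      then show "w = w'" using w by (intro eq_vecI) auto
    qed simp
  next
    fix w assume "w \<in> mat_kernel ?A"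
    then have w: "w \<in> carrier_vec n" "?A *\<^sub>v w = 0\<^sub>v 1"
      using mat_kernelD[OF A] by blast+
    obtain g where g: "\<And>j. j < n \<Longrightarrow> g (vs ! j) = w $ j" using vertex_fun_of_vec[OF w(1)] by blast
    have G: "(\<Sum>x\<in>V. g x) = 0" using A_mult[where g = g, OF w(1) g] w by blast
    have "(- real n + 2) * edge_vec g $ i = 4 * total (edge_vec g) - (\<Sum>x\<in>es ! i. vertex_sum (edge_vec g) x)"
      if "i < m" for i
    proof -
      have "(\<Sum>x\<in>es ! i. vertex_sum (edge_vec g) x) = (\<Sum>x\<in>es ! i. (real n - 2) * g x)"
        using edge(1)[OF that] G by (intro sum.cong refl) (auto simp: vertex_sum_edge_vec subset_iff)
      also have "\<dots> = (real n - 2) * edge_vec g $ i"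
        using that by (simp add: edge_vec_def sum_distrib_left)
      finally show ?thesis using G by (simp add: total_edge_vec algebra_simps)
    qed
    moreover have "incidence *\<^sub>v w = edge_vec g"
      by (rule incidence_mult[OF w(1)]) (rule g)
    ultimately show "incidence *\<^sub>v w \<in> ?K"
      unfolding mem_eigenspace_iff[OF c] by simp
  next
    fix v assume v: "v \<in> ?K"
    have v': "v \<in> carrier_vec m" using v mem_eigenspace_iff[OF c] by blast
    have "V \<noteq> {}" using card_V n_ge_3 by auto
    \<comment> \<open>At \<open>t = -n\<close> the left side of \<open>eigenspace_vertex_sum\<close>
      vanishes while \<open>4n - 6\<close> does not.\<close>
    then have s: "total v = 0" using eigenspace_vertex_sum[OF c v] n2 by auto
    \<comment> \<open>With total 0 the eigenvector equation reads \<open>(n - 2) v = B z\<close> for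
      the vertex sums \<open>z\<close>, so \<open>z / (n - 2)\<close> is a preimage of
      \<open>v\<close>.\<close>
    define g where "g x = vertex_sum v x / (real n - 2)" for x
    let ?w = "vec n (\<lambda>j. g (vs ! j))"
    have w: "?w \<in> carrier_vec n" "\<And>j. j < n \<Longrightarrow> g (vs ! j) = ?w $ j" by auto
    have "(\<Sum>x\<in>V. g x) = 0"
      using s by (simp add: g_def sum_divide_distrib[symmetric] sum_vertex_sum)
    then have "?w \<in> mat_kernel ?A" using A_mult[where g = g, OF w] by (intro mat_kernelI[OF A]) auto
    moreover have "v = edge_vec g"
    proof (rule eq_vecI)
      show "dim_vec v = dim_vec (edge_vec g)"
        using v' by (simp add: edge_vec_def)
      fix i assume "i < dim_vec (edge_vec g)"
      then have i: "i < m" by (simp add: edge_vec_def)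
      have "(- real n + 2) * v $ i = - (\<Sum>x\<in>es ! i. vertex_sum v x)"
        using v i s unfolding mem_eigenspace_iff[OF c] by simp
      then show "v $ i = edge_vec g $ i"
        using i n2 by (simp add: edge_vec_def g_def sum_divide_distrib[symmetric] field_simps)
    qed
    ultimately show "\<exists>w\<in>mat_kernel ?A. v = incidence *\<^sub>v w"
      using incidence_mult[where g = g, OF w] by metis
  qed
  then have "kernel_dim ?A = kernel_dim (char_matrix (overlap_mat c) (c * (- real n)))"
    by (intro kernel_dim_cong_bij[OF A, of _ m m]) auto
  moreover have "kernel_dim ?A + 1 = n"
  proof (rule kernel_dim_surj[OF A])
    fix w :: "real vec" assume w: "w \<in> carrier_vec 1"
    have "?A *\<^sub>v vec n (\<lambda>_. w $ 0 / real n) = w"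
      using w n2 by (intro eq_vecI) (auto simp: scalar_prod_def)
    then show "\<exists>v\<in>carrier_vec n. ?A *\<^sub>v v = w" by (metis vec_carrier)
  qed
  ultimately show ?thesis by simp
qed

text \<open>The eigenvectors are the nonzero constant vectors, images of the one-dimensional space
  under a column of ones. That space is written as the kernel of a matrix without rows so that
  \<open>kernel_dim_cong_bij\<close> applies.\<close>

lemma eigenspace_dim_top:
  assumes c: "c \<noteq> 0"
  shows "kernel_dim (char_matrix (overlap_mat c) (c * (2 * real n * (real n - 2)))) = 1"
proof -
  let ?t = "2 * real n * (real n - 2)"
  let ?A = "0\<^sub>m 0 1 :: real mat" and ?Q = "mat m 1 (\<lambda>_. 1 :: real)"
  let ?K = "mat_kernel (char_matrix (overlap_mat c) (c * ?t))"
  have A: "?A \<in> carrier_mat 0 1" by simp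
  have n2: "real n - 2 > 0" "real n > 0" "2 * real n - 3 > 0" "real n - 1 > 0" using n_ge_3 by auto
  \<comment> \<open>An edge exists, so the constant can be read off at coordinate 0.\<close>
  have "2 * real m \<noteq> 0" unfolding of_nat_m using n2 by simp
  then have m0: "m > 0" by simp
  \<comment> \<open>Half the constant at each of the two ends gives the constant on every
    edge.\<close>
  have Q: "?Q *\<^sub>v w = edge_vec (\<lambda>_. w $ 0 / 2)" if "w \<in> carrier_vec 1" for w
    using that by (intro eq_vecI) (auto simp: scalar_prod_def edge_vec_def edge(2))
  have "bij_betw ((*\<^sub>v) ?Q) (mat_kernel ?A) ?K"
  proof (rule bij_betwI')
    fix w w' assume "w \<in> mat_kernel ?A" "w' \<in> mat_kernel ?A"
    then have w: "w \<in> carrier_vec 1" "w' \<in> carrier_vec 1"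
      using mat_kernelD[OF A] by blast+
    show "(?Q *\<^sub>v w = ?Q *\<^sub>v w') = (w = w')"
    proof
      assume "?Q *\<^sub>v w = ?Q *\<^sub>v w'"
      then have "edge_vec (\<lambda>_. w $ 0 / 2) $ 0 = edge_vec (\<lambda>_. w' $ 0 / 2) $ 0"
        using Q w by simp
      then have "w $ 0 = w' $ 0" using m0 by (simp add: edge_vec_def edge(2))
      then show "w = w'" using w by (intro eq_vecI) auto
    qed simp
  next
    fix w assume "w \<in> mat_kernel ?A"
    then have w: "w \<in> carrier_vec 1" using mat_kernelD[OF A] by blast
    let ?g = "\<lambda>_ :: 'v. w $ 0 / 2"
    have "(?t + 2) * edge_vec ?g $ i = 4 * total (edge_vec ?g) - (\<Sum>x\<in>es ! i. vertex_sum (edge_vec ?g) x)"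
      if "i < m" for i
    proof -
      have "(\<Sum>x\<in>es ! i. vertex_sum (edge_vec ?g) x) = (\<Sum>x\<in>es ! i. (real n - 1) * w $ 0)"
        using edge(1)[OF that]
        by (intro sum.cong refl) (auto simp: vertex_sum_edge_vec subset_iff card_V field_simps)
      then show ?thesis using that
        by (simp add: total_edge_vec card_V edge(2)) (simp add: edge_vec_def edge(2) algebra_simps)
    qed
    then show "?Q *\<^sub>v w \<in> ?K"
      unfolding Q[OF w] mem_eigenspace_iff[OF c] by simp
  next
    fix v assume v: "v \<in> ?K"
    have v': "v \<in> carrier_vec m" using v mem_eigenspace_iff[OF c] by blast
    \<comment> \<open>Here \<open>t + n = n (2n - 3)\<close> and \<open>4n - 6 = 2 (2n - 3)\<close>,
      and the common factor cancels.\<close>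
    have z: "vertex_sum v y = 2 * total v / real n" if "y \<in> V" for y
    proof -
      have "(?t + real n) * vertex_sum v y = (4 * real n - 6) * total v"
        by (rule eigenspace_vertex_sum[OF c v that])
      then have "(2 * real n - 3) * (real n * vertex_sum v y) = (2 * real n - 3) * (2 * total v)"
        by (simp add: algebra_simps)
      then have "real n * vertex_sum v y = 2 * total v" using n2 by simp
      then show ?thesis using n2 by (simp add: field_simps)
    qed
    have "0 < ?t + 2" using n2 by (simp add: add_pos_pos)
    define a where "a = (4 * total v - 4 * total v / real n) / (?t + 2)"
    let ?w = "vec 1 (\<lambda>_. a)"
    have w: "?w \<in> carrier_vec 1" by simp
    have "v = edge_vec (\<lambda>_. ?w $ 0 / 2)"
    proof (rule eq_vecI)
      show "dim_vec v = dim_vec (edge_vec (\<lambda>_. ?w $ 0 / 2))"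
        using v' by (simp add: edge_vec_def)
      fix i assume "i < dim_vec (edge_vec (\<lambda>_. ?w $ 0 / 2))"
      then have i: "i < m" by (simp add: edge_vec_def)
      have "(\<Sum>x\<in>es ! i. vertex_sum v x) = (\<Sum>x\<in>es ! i. 2 * total v / real n)"
        using edge(1)[OF i] by (intro sum.cong refl) (auto simp: z)
      then have "(?t + 2) * v $ i = 4 * total v - 4 * total v / real n"
        using v i unfolding mem_eigenspace_iff[OF c] by (simp add: edge(2))
      then have "v $ i = a" using \<open>0 < ?t + 2\<close> unfolding a_def by (metis nonzero_mult_div_cancel_left less_irrefl)
      then show "v $ i = edge_vec (\<lambda>_. ?w $ 0 / 2) $ i"
        using i by (simp add: edge_vec_def edge(2))
    qed
    moreover have "?w \<in> mat_kernel ?A" by (intro mat_kernelI[OF A]) auto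
    ultimately show "\<exists>w\<in>mat_kernel ?A. v = ?Q *\<^sub>v w" using Q[OF w] by metis
  qed
  then have "kernel_dim ?A = kernel_dim (char_matrix (overlap_mat c) (c * ?t))"
    by (intro kernel_dim_cong_bij[OF A, of _ m m]) auto
  moreover have "kernel_dim ?A + 0 = 1"
    by (rule kernel_dim_surj[OF A]) (auto intro!: bexI[of _ "0\<^sub>v 1"] eq_vecI)
  ultimately show ?thesis by simp
qed

end

text \<open>For \<open>n = 3\<close> there are exactly three edges, so the eigenspace for the first
  value has dimension \<open>3 - 3 = 0\<close> and this value is not an eigenvalue; hence the case
  distinction in the set of eigenvalues.\<close>

theorem theorem3p2:
  fixes n :: nat and V :: "'v set" and es :: "'v set list" and H :: "real mat"
  assumes "n \<ge> 3"
    and "finite V" and "card V = n"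
    and "distinct es" and "set es = complete_edges V"
    and "H = hessian_mat_at_one V es"
  shows "{k. eigenvalue H k} =
      (if n = 3 then {- (real n ^ (n - 3)), 2 * (real n - 2) * real n ^ (n - 3)}
       else {- 2 * real n powi (int n - 4), - (real n ^ (n - 3)),
             2 * (real n - 2) * real n ^ (n - 3)}) \<and>
    eigenspace_dim H (- 2 * real n powi (int n - 4)) = (n choose 2) - n \<and>
    eigenspace_dim H (- (real n ^ (n - 3))) = n - 1 \<and>
    eigenspace_dim H (2 * (real n - 2) * real n ^ (n - 3)) = 1"
proof -
  obtain vs where vs: "set vs = V" "distinct vs" using finite_distinct_list[OF assms(2)] by blast
  have "length vs = n" using vs assms(3) distinct_card by metis
  then interpret complete_graph_enumeration V vs es n "length es"
    using vs assms by unfold_locales auto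
  define c where "c = real n powi (int n - 4)"
  have c: "c \<noteq> 0" using assms(1) by (simp add: c_def)
  have H: "H = overlap_mat c"
    unfolding assms(6)
  proof (rule eq_matI)
    fix i j assume "i < dim_row (overlap_mat c)" "j < dim_col (overlap_mat c)"
    then have "i < length es" "j < length es" by (simp_all add: overlap_mat_def)
    then show "hessian_mat_at_one V es $$ (i, j) = overlap_mat c $$ (i, j)"
      using hessian_complete_graph_entry[OF assms(2,3,1,5,4)] by (simp add: overlap_mat_def c_def)
  qed (simp_all add: hessian_mat_at_one_def hessian_mat_def overlap_mat_def)
  have "c * real n = real n powi (int n - 4 + 1)"
    using assms(1) power_int_add[of "real n" "int n - 4" 1] by (simp add: c_def)
  also have "int n - 4 + 1 = int (n - 3)" using assms(1) by simp
  finally have cn: "c * real n = real n ^ (n - 3)" by (simp only: power_int_of_nat)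
  have ev: "- 2 * real n powi (int n - 4) = c * (- 2)" "- (real n ^ (n - 3)) = c * (- real n)"
    "2 * (real n - 2) * real n ^ (n - 3) = c * (2 * real n * (real n - 2))"
    unfolding cn[symmetric] by (simp_all add: c_def)
  have dim: "eigenspace_dim H (c * (- 2)) = (n choose 2) - n" "eigenspace_dim H (c * (- real n)) = n - 1"
    "eigenspace_dim H (c * (2 * real n * (real n - 2))) = 1"
    using eigenspace_dim_minus_2[OF c] eigenspace_dim_minus_n[OF c] eigenspace_dim_top[OF c] m_eq
    unfolding eigenspace_dim_def H by linarith+
  have eig: "eigenvalue H k \<longleftrightarrow> eigenspace_dim H k \<noteq> 0" for k
    unfolding eigenspace_dim_def H by (rule eigenvalue_iff_kernel_dim[OF overlap_mat_carrier])
  have three: "k \<in> {c * (- 2), c * (- real n), c * (2 * real n * (real n - 2))}"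
    if k_ev: "eigenvalue H k" for k
  proof (rule ccontr)
    assume k: "k \<notin> {c * (- 2), c * (- real n), c * (2 * real n * (real n - 2))}"
    define t where "t = k / c"
    have kt: "k = c * t" using c by (simp add: t_def)
    have t: "t \<noteq> - 2" "t \<noteq> - real n" "t \<noteq> 2 * real n * (real n - 2)" using k unfolding kt by blast+
    obtain v where v: "v \<in> carrier_vec (length es)" "v \<noteq> 0\<^sub>v (length es)"
      "char_matrix H k *\<^sub>v v = 0\<^sub>v (length es)"
      using k_ev unfolding H eigenvalue_char_matrix[OF overlap_mat_carrier] by blast
    then have "v \<in> mat_kernel (char_matrix (overlap_mat c) (c * t))"
      unfolding H kt by (intro mat_kernelI[OF char_matrix_closed[OF overlap_mat_carrier]])
    then show False using eigenspace_trivial[OF c t] v(2) by blast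
  qed
  have small: "(n choose 2) - n = 0 \<longleftrightarrow> n = 3"
  proof -
    have "2 * (n choose 2) = n * (n - 1)" unfolding choose_two by (intro dvd_mult_div_cancel) auto
    moreover have "n * (n - 1) \<le> n * 2 \<longleftrightarrow> n = 3" using assms(1) by (subst mult_le_cancel1) auto
    ultimately show ?thesis by linarith
  qed
  have is_ev: "eigenvalue H (c * (- 2)) \<longleftrightarrow> n \<noteq> 3" "eigenvalue H (c * (- real n))"
    "eigenvalue H (c * (2 * real n * (real n - 2)))"
    unfolding eig dim using small assms(1) by simp_all
  have "{k. eigenvalue H k} =
      (if n = 3 then {c * (- real n), c * (2 * real n * (real n - 2))}
       else {c * (- 2), c * (- real n), c * (2 * real n * (real n - 2))})" (is "_ = ?R")
  proof (intro equalityI subsetI)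
    fix k assume "k \<in> {k. eigenvalue H k}"
    then have k: "eigenvalue H k" by simp
    from three[OF k] show "k \<in> ?R" using k is_ev(1) by (metis insertE insertI1 insertI2)
  next
    fix k assume "k \<in> ?R"
    then show "k \<in> {k. eigenvalue H k}" using is_ev by (metis empty_iff insert_iff mem_Collect_eq)
  qed
  then show ?thesis unfolding ev using dim by blast
qed

end
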